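(* Let $X=(X_n)_{n\in\mathbb{N}}$ be a sequential jittered sampling sequence. (i) It is not the case that $X$ has Poissonian pair correlations almost surely. (ii) In contrast, almost surely $X$ has $\alpha$-Poissonian pair correlations for every $\alpha\in(0,1)$.
   Context: A jittered sample of size $N$ is a random tuple $(X_1,\ldots,X_N)$ in $[0,1)$ given by $X_n=\frac{\pi(n)-1+Y_n}{N}$ for $1\le n\le N$, where $\pi$ is a uniformly random permutation of $\{1,\ldots,N\}$, $Y_1,\ldots,Y_N$ are uniformly distributed on $[0,1)$, and $\pi,Y_1,\ldots,Y_N$ are independent. A sequential jittered sampling sequence $(X_n)_{n\in\mathbb{N}}$ is constructed inductively. The pair $(X_1,X_2)$ is a jittered sample of size $2$. Assume $N=2^n$ points $X_1,\ldots,X_N$ ($n\ge 1$) have been constructed. Split $[0,1)$ into the $2N$ intervals $[\frac{m}{2N},\frac{m+1}{2N})$, $0\le m<2N$; exactly $N$ of these contain none of $X_1,\ldots,X_N$, and these are listed in increasing order as $[c_1,c_1+\frac1{2N}),\ldots,[c_N,c_N+\frac1{2N})$. Let $\pi$ be a uniformly random permutation of $\{1,\ldots,N\}$ and $Z_1,\ldots,Z_N$ uniformly distributed on $[0,1)$, all independent of each other and of everything constructed before, and set $X_{N+k}=c_{\pi(k)}+\frac{Z_k}{2N}$ for $1\le k\le N$. $\|\cdot\|$ denotes the distance of a real number to its closest integer. For $0<\alpha\le 1$, a sequence $(x_n)_{n\in\mathbb{N}}$ in $[0,1)$ has $\alpha$-Poissonian pair correlations ($\alpha$-PPC) if for all $s\ge0$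 $$\lim_{N\to\infty}\frac{1}{N^{2-\alpha}}\,\#\left\{(i,j): 1\le i\ne j\le N,\ \|x_i-x_j\|\le \frac{s}{N^\alpha}\right\}=2s.$$ Poissonian pair correlations (PPC) means $\alpha$-PPC with $\alpha=1$. *)

theory Defs
  imports "HOL-Probability.Probability" "HOL-Combinatorics.Permutations"
begin

section \<open>Pair correlations\<close>

text \<open>Sequences are indexed by the positive integers; the value at index \<open>0\<close> is never used.\<close>

definition nearest_int_dist :: "real \<Rightarrow> real" where
  "nearest_int_dist t = \<bar>t - of_int (round t)\<bar>"

definition alpha_ppc :: "real \<Rightarrow> (nat \<Rightarrow> real) \<Rightarrow> bool" where
  "alpha_ppc \<alpha> x \<longleftrightarrow>
     (\<forall>s\<ge>0. (\<lambda>N. real (card {(i, j). i \<in> {1..N} \<and> j \<in> {1..N} \<and> i \<noteq> j \<and>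
                    nearest_int_dist (x i - x j) \<le> s / real N powr \<alpha>})
              / real N powr (2 - \<alpha>)) \<longlonglongrightarrow> 2 * s)"

definition ppc :: "(nat \<Rightarrow> real) \<Rightarrow> bool" where
  "ppc x \<longleftrightarrow> alpha_ppc 1 x"

section \<open>The construction for one realisation of the permutations and the uniform variables\<close>

definition jittered_point :: "nat \<Rightarrow> (nat \<Rightarrow> nat) \<Rightarrow> (nat \<Rightarrow> real) \<Rightarrow> nat \<Rightarrow> real" where
  "jittered_point N p y n = (real (p n) - 1 + y n) / real N"

text \<open>The numbers \<open>m\<close> of the cells \<open>[m / 2N, (m + 1) / 2N)\<close> that contain none of
  \<open>x 1, \<dots>, x N\<close>.\<close>

definition free_cells :: "(nat \<Rightarrow> real) \<Rightarrow> nat \<Rightarrow> nat set" where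
  "free_cells x N =
     {m \<in> {0..<2 * N}. \<forall>i\<in>{1..N}. x i \<notin> {real m / real (2 * N)..<real (m + 1) / real (2 * N)}}"

text \<open>The left end point \<open>c\<^sub>k\<close> of the \<open>k\<close>-th free cell, for \<open>1 \<le> k \<le> N\<close>.\<close>

definition free_left :: "(nat \<Rightarrow> real) \<Rightarrow> nat \<Rightarrow> nat \<Rightarrow> real" where
  "free_left x N k = real (sorted_list_of_set (free_cells x N) ! (k - 1)) / real (2 * N)"

text \<open>\<open>p 0\<close> is the permutation for the initial pair and \<open>p n\<close>, for \<open>n \<ge> 1\<close>, the one used to
  pass from \<open>2^n\<close> to \<open>2^(n+1)\<close> points. The uniform variables are numbered by the point they
  belong to: \<open>u 1\<close> and \<open>u 2\<close> are the \<open>Y\<close>'s of the initial pair, and \<open>u (2^n + k)\<close> is the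
  variable \<open>Z\<^sub>k\<close> of step \<open>n\<close>.\<close>

definition sequential_jittering ::
  "(nat \<Rightarrow> nat \<Rightarrow> nat) \<Rightarrow> (nat \<Rightarrow> real) \<Rightarrow> (nat \<Rightarrow> real) \<Rightarrow> bool" where
  "sequential_jittering p u x \<longleftrightarrow>
     (\<forall>n\<in>{1..2}. x n = jittered_point 2 (p 0) u n) \<and>
     (\<forall>n\<ge>1. \<forall>k\<in>{1..2 ^ n}.
        x (2 ^ n + k) = free_left x (2 ^ n) (p n k) + u (2 ^ n + k) / real (2 * 2 ^ n))"

section \<open>The random sequence\<close>

definition step_size :: "nat \<Rightarrow> nat" where
  "step_size n = (if n = 0 then 2 else 2 ^ n)"

definition step_perms :: "nat \<Rightarrow> (nat \<Rightarrow> nat) set" where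
  "step_perms n = {p. p permutes {1..step_size n}}"

text \<open>The permutations and the real variables have different value types, so their joint
  independence is expressed through the \<open>\<sigma>\<close>-algebras they generate.\<close>

definition sequential_jitter_source ::
  "'a measure \<Rightarrow> (nat \<Rightarrow> 'a \<Rightarrow> nat \<Rightarrow> nat) \<Rightarrow> (nat \<Rightarrow> 'a \<Rightarrow> real) \<Rightarrow> bool" where
  "sequential_jitter_source M \<pi> U \<longleftrightarrow>
     (\<forall>n. \<pi> n \<in> measurable M (count_space (step_perms n)) \<and>
          distr M (count_space (step_perms n)) (\<pi> n) = uniform_count_measure (step_perms n)) \<and>
     (\<forall>i\<ge>1. U i \<in> borel_measurable M \<and>
          distr M lborel (U i) = uniform_measure lborel {0..<1}) \<and>
     prob_space.indep_sets M
       (case_sum (\<lambda>n. sets (vimage_algebra (space M) (\<pi> n) (count_space (step_perms n))))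
                 (\<lambda>i. sets (vimage_algebra (space M) (U i) borel)))
       (UNIV <+> {1..})"

definition sequential_jittered_sampling :: "'a measure \<Rightarrow> (nat \<Rightarrow> 'a \<Rightarrow> real) \<Rightarrow> bool" where
  "sequential_jittered_sampling M X \<longleftrightarrow> prob_space M \<and>
     (\<exists>\<pi> U. sequential_jitter_source M \<pi> U \<and>
        (\<forall>\<omega>\<in>space M. sequential_jittering (\<lambda>n. \<pi> n \<omega>) (\<lambda>i. U i \<omega>) (\<lambda>n. X n \<omega>)))"

end

theory Submission
  imports Defs "HOL-Library.Discrete_Functions"
begin

text \<open>
  After \<open>N = 2 ^ n\<close> points every cell \<open>[c / N, (c + 1) / N)\<close> contains exactly one of them.

  Poissonian pair correlations fail for every realisation with all \<open>U i\<close> in \<open>[0, 1)\<close>: for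
  \<open>s \<le> 1\<close> only cyclically adjacent points can be at distance at most \<open>s / N\<close>, and the \<open>N\<close> gaps between adjacent points sum to \<open>1\<close> and are at most
  \<open>2 / N\<close>. The limits required for \<open>s = 1\<close> and \<open>s = 1 / 2\<close> would make almost all gaps at most
  \<open>1 / N\<close> and half of them at most \<open>1 / (2 * N)\<close>, so that the gaps could not sum to \<open>1\<close>.

  For \<open>\<alpha> < 1\<close>, counting pairs by the difference of the blocks containing the two points shows
  that a small total deviation of the block counts at scale \<open>N powr - (1 - 1 / m)\<close> implies
  \<open>\<alpha>\<close>-PPC for every \<open>\<alpha> < 1 - 1 / m\<close>. Between \<open>2 ^ n\<close> and \<open>2 ^ (n + 1)\<close> the block counts depend
  on the permutation \<open>\<pi> n\<close> only. The number of the first \<open>K\<close> values of a uniform permutation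
  that fall into a set of size \<open>h\<close> has variance at most \<open>h\<close>, so the expected deviations at finitely
  many intermediate times are summable in \<open>n\<close>. The other times follow since the counts are
  monotone.
\<close>

section \<open>Counting close pairs by cells\<close>

text \<open>\<open>nat\<close> sends negative arguments to cell 0, so the lemmas about cells assume
  \<open>0 \<le> t\<close>.\<close>

definition cell :: "nat \<Rightarrow> real \<Rightarrow> nat" where
  "cell M t = nat \<lfloor>real M * t\<rfloor>"

definition cell_count :: "(nat \<Rightarrow> real) \<Rightarrow> nat \<Rightarrow> nat \<Rightarrow> nat \<Rightarrow> nat" where
  "cell_count x L M b = card {i \<in> {1..L}. cell M (x i) = b}"

text \<open>An l1 deviation over the cells of one partition, not the classical supremum over
  intervals. It bounds the error made when one factor of a correlation sum is replaced by its
  mean.\<close>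

definition discrepancy :: "(nat \<Rightarrow> real) \<Rightarrow> nat \<Rightarrow> nat \<Rightarrow> real" where
  "discrepancy x L M = (\<Sum>b<M. \<bar>real (cell_count x L M b) - real L / real M\<bar>)"

definition close_pairs :: "(nat \<Rightarrow> real) \<Rightarrow> nat \<Rightarrow> real \<Rightarrow> (nat \<times> nat) set" where
  "close_pairs x L r =
     {(i, j). i \<in> {1..L} \<and> j \<in> {1..L} \<and> i \<noteq> j \<and> nearest_int_dist (x i - x j) \<le> r}"

text \<open>Cells are compared modulo \<open>M\<close> because the distance to the nearest integer
  is a distance on the circle. Diagonal pairs stay in, so that the cardinality is exactly a sum of
  products of cell counts; \<open>card_close_pairs_ge\<close> pays for them.\<close>

definition shifted_pairs :: "(nat \<Rightarrow> real) \<Rightarrow> nat \<Rightarrow> nat \<Rightarrow> int \<Rightarrow> (nat \<times> nat) set" where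
  "shifted_pairs x L M t = {(i, j). i \<in> {1..L} \<and> j \<in> {1..L} \<and>
     int (cell M (x j)) = (int (cell M (x i)) + t) mod int M}"

text \<open>Rounding minimises the distance over all integers. The integer \<open>k\<close> obtained
  here records the wrap-around in the counting arguments.\<close>

lemma nearest_int_dist_le_iff: "nearest_int_dist t \<le> r \<longleftrightarrow> (\<exists>k::int. \<bar>t - of_int k\<bar> \<le> r)"
  unfolding nearest_int_dist_def by (meson order_trans round_diff_minimal)

lemma finite_close_pairs [simp]: "finite (close_pairs x L r)"
  by (rule finite_subset[of _ "{1..L} \<times> {1..L}"]) (auto simp: close_pairs_def)

lemma finite_shifted_pairs [simp]: "finite (shifted_pairs x L M t)"
  by (rule finite_subset[of _ "{1..L} \<times> {1..L}"]) (auto simp: shifted_pairs_def)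

section \<open>Elementary properties of cells\<close>

lemma cell_eq_iff:
  assumes "0 \<le> t"
  shows "cell M t = c \<longleftrightarrow> real c \<le> real M * t \<and> real M * t < real c + 1"
proof -
  have "0 \<le> real M * t" using assms by simp
  then show ?thesis unfolding cell_def by (simp add: nat_eq_iff) linarith
qed

lemma cell_bounds:
  assumes "0 \<le> t"
  shows "real (cell M t) \<le> real M * t" "real M * t < real (cell M t) + 1"
  using cell_eq_iff[OF assms, of M "cell M t"] by simp_all

lemma cell_less:
  assumes "0 \<le> t" "t < 1" "0 < M"
  shows "cell M t < M"
proof -
  have "real M * t < real M * 1" using assms by (intro mult_strict_left_mono) auto
  then show ?thesis using cell_bounds(1)[OF assms(1), of M] by linarith
qed

text \<open>Nested floors collapse. This links the partition that separates the points to its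
  refinement by two and to its coarser blocks.\<close>

lemma cell_mult_div:
  assumes "0 \<le> t" "0 < q"
  shows "cell (M * q) t div q = cell M t"
proof -
  have "\<lfloor>real M * t\<rfloor> = \<lfloor>real (M * q) * t\<rfloor> div int q"
    using assms floor_divide_real_eq_div[of "int q" "real (M * q) * t"] by (simp add: field_simps)
  then show ?thesis
    using assms by (simp add: cell_def nat_div_distrib)
qed

lemma sum_cell_count:
  fixes g :: "nat \<Rightarrow> real"
  assumes "\<And>i. i \<in> {1..L} \<Longrightarrow> cell M (x i) < M"
  shows "(\<Sum>i\<in>{1..L}. g (cell M (x i))) = (\<Sum>b<M. real (cell_count x L M b) * g b)"
proof -
  have "(\<Sum>i\<in>{1..L}. g (cell M (x i)))
      = (\<Sum>b<M. \<Sum>i\<in>{i \<in> {1..L}. cell M (x i) = b}. g (cell M (x i)))"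
    by (rule sum.group[symmetric]) (use assms in auto)
  also have "\<dots> = (\<Sum>b<M. real (cell_count x L M b) * g b)"
    by (intro sum.cong refl) (simp add: cell_count_def)
  finally show ?thesis .
qed

section \<open>Pairs of points with a prescribed difference of cells\<close>

lemma bij_betw_cyclic_shift:
  fixes t :: int
  assumes "0 < M"
  shows "bij_betw (\<lambda>b. nat ((int b + t) mod int M)) {..<M} {..<M}"
proof (rule bij_betwI[where g = "\<lambda>b. nat ((int b - t) mod int M)"])
qed (use assms in \<open>auto simp: nat_less_iff mod_simps\<close>)

text \<open>The cardinality is the sum of \<open>c b * c (\<tau> b)\<close> over the cells
  \<open>b\<close>, where \<open>c\<close> counts points and \<open>\<tau>\<close> is the cyclic
  shift. Replacing the second factor by \<open>L / M\<close> gives the main term. In the error the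
  first factor is bounded by \<open>C * L / M\<close>, and the deviations add up to the discrepancy
  since \<open>\<tau>\<close> is a bijection.\<close>

lemma card_shifted_pairs:
  assumes x: "\<And>i. i \<in> {1..L} \<Longrightarrow> 0 \<le> x i \<and> x i < 1" and M: "0 < M"
    and C: "\<And>b. b < M \<Longrightarrow> real (cell_count x L M b) \<le> C * real L / real M"
  shows "\<bar>real (card (shifted_pairs x L M t)) - (real L)\<^sup>2 / real M\<bar>
           \<le> C * real L / real M * discrepancy x L M"
proof -
  define \<tau> where "\<tau> b = nat ((int b + t) mod int M)" for b
  let ?c = "cell_count x L M"
  have f: "cell M (x i) < M" if "i \<in> {1..L}" for i
    using x[OF that] M by (auto intro: cell_less)
  have "shifted_pairs x L M t
      = Sigma {1..L} (\<lambda>i. {j \<in> {1..L}. cell M (x j) = \<tau> (cell M (x i))})"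
    using M by (auto simp: shifted_pairs_def \<tau>_def)
  then have "real (card (shifted_pairs x L M t)) = (\<Sum>i\<in>{1..L}. real (?c (\<tau> (cell M (x i)))))"
    by (simp add: cell_count_def)
  also have "\<dots> = (\<Sum>b<M. real (?c b) * real (?c (\<tau> b)))"
    using sum_cell_count[of L M x "\<lambda>b. real (?c (\<tau> b))"] f by simp
  finally have card: "real (card (shifted_pairs x L M t)) = \<dots>" .
  have "(\<Sum>b<M. real (?c b)) = real L"
    using sum_cell_count[of L M x "\<lambda>_. 1"] f by simp
  then have "(real L)\<^sup>2 / real M = (\<Sum>b<M. real (?c b) * (real L / real M))"
    unfolding sum_distrib_right[symmetric] by (simp add: power2_eq_square)
  with card have "\<bar>real (card (shifted_pairs x L M t)) - (real L)\<^sup>2 / real M\<bar>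
      = \<bar>\<Sum>b<M. real (?c b) * (real (?c (\<tau> b)) - real L / real M)\<bar>"
    by (simp add: sum_subtractf right_diff_distrib)
  also have "\<dots> \<le> (\<Sum>b<M. \<bar>real (?c b) * (real (?c (\<tau> b)) - real L / real M)\<bar>)"
    by (rule sum_abs)
  also have "\<dots> \<le> (\<Sum>b<M. C * real L / real M * \<bar>real (?c (\<tau> b)) - real L / real M\<bar>)"
    unfolding abs_mult using C by (intro sum_mono mult_right_mono) auto
  also have "\<dots> = C * real L / real M * (\<Sum>b<M. \<bar>real (?c (\<tau> b)) - real L / real M\<bar>)"
    by (simp add: sum_distrib_left)
  also have "(\<Sum>b<M. \<bar>real (?c (\<tau> b)) - real L / real M\<bar>) = discrepancy x L M"
    unfolding discrepancy_def \<tau>_def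
    by (rule sum.reindex_bij_betw[OF bij_betw_cyclic_shift[OF M]])
  finally show ?thesis .
qed

text \<open>Replacing \<open>M * x i\<close> and \<open>M * x j\<close> by their floors changes
  their difference by less than 1, so the integer shift stays below
  \<open>r * M + 1\<close>.\<close>

lemma close_pairs_subset_shifted:
  assumes x: "\<And>i. i \<in> {1..L} \<Longrightarrow> 0 \<le> x i \<and> x i < 1" and M: "0 < M"
  shows "close_pairs x L r \<subseteq> (\<Union>t\<in>{-\<lceil>r * real M\<rceil>..\<lceil>r * real M\<rceil>}. shifted_pairs x L M t)"
proof clarify
  fix i j assume "(i, j) \<in> close_pairs x L r"
  then have ij: "i \<in> {1..L}" "j \<in> {1..L}" and "nearest_int_dist (x i - x j) \<le> r"
    by (auto simp: close_pairs_def)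
  then obtain k :: int where k: "\<bar>x i - x j - of_int k\<bar> \<le> r"
    by (auto simp: nearest_int_dist_le_iff)
  \<comment> \<open>The multiple of \<open>M\<close> makes \<open>t\<close> approximate
    \<open>M * (x j - x i + k)\<close>; it vanishes modulo \<open>M\<close>.\<close>
  define t where "t = int (cell M (x j)) - int (cell M (x i)) + k * int M"
  have scale: "real M * x i - real M * x j - real M * of_int k = real M * (x i - x j - of_int k)"
    by (simp add: right_diff_distrib)
  have "\<bar>real M * (x i - x j - of_int k)\<bar> \<le> real M * r"
    unfolding abs_mult using k by (simp add: mult_left_mono)
  then have "\<bar>real M * x i - real M * x j - real M * of_int k\<bar> \<le> r * real M"
    unfolding scale by (simp add: mult.commute)
  moreover note cell_bounds[of "x i" M] cell_bounds[of "x j" M]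
  moreover have "of_int t = real (cell M (x j)) - real (cell M (x i)) + real M * of_int k"
    by (simp add: t_def)
  ultimately have "\<bar>of_int t\<bar> < r * real M + 1"
    using x[OF ij(1)] x[OF ij(2)] by linarith
  then have "t \<in> {-\<lceil>r * real M\<rceil>..\<lceil>r * real M\<rceil>}" by (simp, linarith)
  moreover have "cell M (x j) < M" using x[OF ij(2)] M by (auto intro: cell_less)
  then have "(i, j) \<in> shifted_pairs x L M t"
    using ij by (simp add: shifted_pairs_def t_def)
  ultimately show "(i, j) \<in> (\<Union>t\<in>{-\<lceil>r * real M\<rceil>..\<lceil>r * real M\<rceil>}. shifted_pairs x L M t)"
    by blast
qed

text \<open>The converse of the previous rounding argument: the floors again cost less than 1, which
  the extra 1 in the bound on \<open>t\<close> absorbs.\<close>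

lemma shifted_subset_close_pairs:
  assumes x: "\<And>i. i \<in> {1..L} \<Longrightarrow> 0 \<le> x i \<and> x i < 1" and M: "0 < M"
    and t: "\<bar>real_of_int t\<bar> + 1 \<le> r * real M"
  shows "shifted_pairs x L M t \<subseteq> close_pairs x L r \<union> (\<lambda>i. (i, i)) ` {1..L}"
proof clarify
  fix i j assume "(i, j) \<in> shifted_pairs x L M t" and nd: "(i, j) \<notin> (\<lambda>i. (i, i)) ` {1..L}"
  then have ij: "i \<in> {1..L}" "j \<in> {1..L}"
    and mod: "int (cell M (x j)) = (int (cell M (x i)) + t) mod int M"
    by (auto simp: shifted_pairs_def)
  define k where "k = (int (cell M (x i)) + t) div int M"
  have "int (cell M (x j)) + int M * k = int (cell M (x i)) + t"
    unfolding mod k_def by (rule mod_mult_div_eq)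
  then have "real (cell M (x j)) + real M * of_int k = real (cell M (x i)) + of_int t"
    by (metis of_int_add of_int_mult of_int_of_nat_eq)
  then have "\<bar>real M * x i - real M * x j - real M * of_int k\<bar> \<le> r * real M"
    using cell_bounds[of "x i" M] cell_bounds[of "x j" M] x[OF ij(1)] x[OF ij(2)] t by linarith
  also have "real M * x i - real M * x j - real M * of_int k = real M * (x i - x j - of_int k)"
    by (simp add: right_diff_distrib)
  finally have "real M * \<bar>x i - x j - of_int k\<bar> \<le> real M * r"
    by (simp add: abs_mult mult.commute)
  then have "\<bar>x i - x j - of_int k\<bar> \<le> r" using M by simp
  then show "(i, j) \<in> close_pairs x L r"
    using nd ij by (auto simp: close_pairs_def nearest_int_dist_le_iff)
qed

text \<open>The admissible shifts number \<open>2 * H + 1\<close> with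
  \<open>H = \<lceil>r * M\<rceil>\<close>, which is at most \<open>2 * r * M + 3\<close>; each
  contributes at most the main term plus the error of \<open>card_shifted_pairs\<close>.\<close>

lemma card_close_pairs_le:
  assumes x: "\<And>i. i \<in> {1..L} \<Longrightarrow> 0 \<le> x i \<and> x i < 1" and M: "0 < M" and r: "0 \<le> r"
    and C: "\<And>b. b < M \<Longrightarrow> real (cell_count x L M b) \<le> C * real L / real M" "0 \<le> C"
  shows "real (card (close_pairs x L r))
           \<le> (2 * (r * real M) + 3) * ((real L)\<^sup>2 / real M + C * real L / real M * discrepancy x L M)"
proof -
  define H where "H = \<lceil>r * real M\<rceil>"
  let ?q = "(real L)\<^sup>2 / real M + C * real L / real M * discrepancy x L M"
  have H: "0 \<le> H" "real_of_int H \<le> r * real M + 1"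
    using r unfolding H_def by (auto intro: less_le_trans[of _ 0] simp: le_ceiling_iff)
  have D: "0 \<le> discrepancy x L M" by (simp add: discrepancy_def sum_nonneg)
  have q: "0 \<le> ?q" using D C(2) by simp
  have "card (close_pairs x L r) \<le> card (\<Union>t\<in>{-H..H}. shifted_pairs x L M t)"
    unfolding H_def using close_pairs_subset_shifted[of L x M r] x M by (intro card_mono) auto
  also have "\<dots> \<le> (\<Sum>t\<in>{-H..H}. card (shifted_pairs x L M t))"
    by (rule card_UN_le) simp
  finally have "real (card (close_pairs x L r)) \<le> (\<Sum>t\<in>{-H..H}. real (card (shifted_pairs x L M t)))"
    by (metis of_nat_le_iff of_nat_sum)
  also have "\<dots> \<le> (\<Sum>t\<in>{-H..H}. ?q)"
    using card_shifted_pairs[of L x M C] x M C by (intro sum_mono) (smt (verit, best))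
  also have "\<dots> = (2 * real_of_int H + 1) * ?q" using H by simp
  also have "\<dots> \<le> (2 * (r * real M) + 3) * ?q"
    using H q by (intro mult_right_mono) auto
  finally show ?thesis .
qed

text \<open>Shifts up to \<open>H = \<lfloor>r * M\<rfloor> - 1\<close> yield only close or diagonal
  pairs. There are at least \<open>2 * r * M - 3\<close> of them, and the diagonal accounts for the
  summand \<open>L\<close>.\<close>

lemma card_close_pairs_ge:
  assumes x: "\<And>i. i \<in> {1..L} \<Longrightarrow> 0 \<le> x i \<and> x i < 1" and M: "0 < M" and r: "r \<le> 1 / 2"
    and C: "\<And>b. b < M \<Longrightarrow> real (cell_count x L M b) \<le> C * real L / real M"
    and q: "0 \<le> (real L)\<^sup>2 / real M - C * real L / real M * discrepancy x L M"
  shows "(2 * (r * real M) - 3) * ((real L)\<^sup>2 / real M - C * real L / real M * discrepancy x L M)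
           \<le> real (card (close_pairs x L r)) + real L"
proof (cases "r * real M < 1")
  \<comment> \<open>Here \<open>H\<close> would be negative, but the factor
    \<open>2 * (r * M) - 3\<close> is negative too and the bound is trivial.\<close>
  case True
  then have "(2 * (r * real M) - 3) * ((real L)\<^sup>2 / real M - C * real L / real M * discrepancy x L M) \<le> 0"
    using q by (intro mult_nonpos_nonneg) auto
  then show ?thesis by (smt (verit) of_nat_0_le_iff)
next
  case False
  define H where "H = \<lfloor>r * real M\<rfloor> - 1"
  let ?q = "(real L)\<^sup>2 / real M - C * real L / real M * discrepancy x L M"
  have H: "0 \<le> H" "real_of_int H + 1 \<le> r * real M" "r * real M - 2 \<le> real_of_int H"
    using False unfolding H_def by (auto, linarith+)
  have "r * real M \<le> 1 / 2 * real M" using r by (intro mult_right_mono) auto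
  then have HM: "2 * H + 1 \<le> int M" using H by linarith
  \<comment> \<open>No pair is counted twice: two shifts differ by at most \<open>2 * H\<close>,
    which is less than \<open>M\<close> because \<open>r \<le> 1 / 2\<close>, so distinct shifts are
    incongruent modulo \<open>M\<close>.\<close>
  have disj: "shifted_pairs x L M s \<inter> shifted_pairs x L M t = {}"
    if st: "s \<in> {-H..H}" "t \<in> {-H..H}" "s \<noteq> t" for s t
  proof (rule ccontr)
    assume "shifted_pairs x L M s \<inter> shifted_pairs x L M t \<noteq> {}"
    then obtain i j where "(i, j) \<in> shifted_pairs x L M s" "(i, j) \<in> shifted_pairs x L M t"
      by (metis disjoint_iff surj_pair)
    then obtain c :: int where "(c + s) mod int M = (c + t) mod int M"
      unfolding shifted_pairs_def by (metis (mono_tags, lifting) case_prodD mem_Collect_eq)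
    then have "int M dvd (c + s) - (c + t)" by (simp add: mod_eq_dvd_iff)
    then have "int M \<le> \<bar>s - t\<bar>" using st dvd_imp_le_int[of "s - t" "int M"] by auto
    then show False using st HM by auto
  qed
  have "(2 * (r * real M) - 3) * ?q \<le> (2 * real_of_int H + 1) * ?q"
    using H q by (intro mult_right_mono) auto
  also have "\<dots> = (\<Sum>t\<in>{-H..H}. ?q)" using H by simp
  also have "\<dots> \<le> (\<Sum>t\<in>{-H..H}. real (card (shifted_pairs x L M t)))"
    using card_shifted_pairs[of L x M C] x M C by (intro sum_mono) (smt (verit, best))
  also have "\<dots> = real (card (\<Union>t\<in>{-H..H}. shifted_pairs x L M t))"
    using disj by (subst card_UN_disjoint) auto
  also have "card (\<Union>t\<in>{-H..H}. shifted_pairs x L M t)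
      \<le> card (close_pairs x L r \<union> (\<lambda>i. (i, i)) ` {1..L})"
  proof (rule card_mono)
    have "shifted_pairs x L M t \<subseteq> close_pairs x L r \<union> (\<lambda>i. (i, i)) ` {1..L}" if "t \<in> {-H..H}" for t
      by (rule shifted_subset_close_pairs) (use x M H that in auto)
    then show "(\<Union>t\<in>{-H..H}. shifted_pairs x L M t) \<subseteq> close_pairs x L r \<union> (\<lambda>i. (i, i)) ` {1..L}"
      by blast
  qed simp
  also have "\<dots> \<le> card (close_pairs x L r) + card ((\<lambda>i. (i, i)) ` {1..L})"
    by (rule card_Un_le)
  also have "card ((\<lambda>i. (i, i)) ` {1..L}) = L"
    by (subst card_image) (auto simp: inj_on_def)
  finally show ?thesis by simp
qed

text \<open>With \<open>r = s / L powr \<alpha>\<close> the main term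
  \<open>2 * r * M * L^2 / M\<close> equals \<open>2 * s * L powr (2 - \<alpha>)\<close>. After
  normalisation, rounding the shifts costs \<open>3 * L powr \<alpha> / M\<close>, uneven cells give
  a factor \<open>1 + C * \<delta>\<close> or \<open>1 - C * \<delta>\<close>, and the diagonal
  costs \<open>L powr (\<alpha> - 1)\<close>, which vanishes because
  \<open>\<alpha> < 1\<close>.\<close>

lemma alpha_ppc_if_discrepancy:
  assumes \<alpha>: "\<alpha> < 1" "0 < \<alpha>" and x: "\<And>i. 1 \<le> i \<Longrightarrow> 0 \<le> x i \<and> x i < 1"
    and M: "\<And>L. 0 < M L"
    and C: "eventually (\<lambda>L. \<forall>b<M L. real (cell_count x L (M L) b) \<le> C * real L / real (M L)) sequentially"
      "0 \<le> C"
    and e: "(\<lambda>L. real L powr \<alpha> / real (M L)) \<longlonglongrightarrow> 0"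
    and d: "(\<lambda>L. discrepancy x L (M L) / real L) \<longlonglongrightarrow> 0"
  shows "alpha_ppc \<alpha> x"
  unfolding alpha_ppc_def
proof (intro allI impI)
  fix s :: real assume s: "0 \<le> s"
  define E where "E L = real L powr \<alpha> / real (M L)" for L
  define \<delta> where "\<delta> L = discrepancy x L (M L) / real L" for L
  have lim: "E \<longlonglongrightarrow> 0" "\<delta> \<longlonglongrightarrow> 0" using e d by (simp_all add: E_def[abs_def] \<delta>_def[abs_def])
  have p: "(\<lambda>L. real L powr (\<alpha> - 1)) \<longlonglongrightarrow> 0"
    by (rule tendsto_neg_powr) (use \<alpha> filterlim_real_sequentially in auto)
  have r: "(\<lambda>L. s * real L powr (-\<alpha>)) \<longlonglongrightarrow> s * 0"
    by (intro tendsto_mult tendsto_const tendsto_neg_powr filterlim_real_sequentially) (use \<alpha> in auto)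
  \<comment> \<open>The lower bound needs a radius of at most 1/2 and a nonnegative main term after
    subtracting the error; both hold for large \<open>L\<close>.\<close>
  have "eventually (\<lambda>L. s * real L powr (-\<alpha>) < 1 / 2) sequentially"
    using order_tendstoD(2)[OF r, of "1 / 2"] by simp
  moreover have "(\<lambda>L. C * \<delta> L) \<longlonglongrightarrow> C * 0" by (intro tendsto_intros lim)
  then have "eventually (\<lambda>L. C * \<delta> L < 1) sequentially" by (auto intro: order_tendstoD(2))
  ultimately have ev: "eventually (\<lambda>L. s * real L powr (-\<alpha>) < 1 / 2 \<and> C * \<delta> L < 1 \<and> 0 < L \<and>
      (\<forall>b<M L. real (cell_count x L (M L) b) \<le> C * real L / real (M L))) sequentially"
    using eventually_gt_at_top[of "0::nat"] C(1) by eventually_elim auto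
  let ?P = "\<lambda>L. real (card (close_pairs x L (s / real L powr \<alpha>))) / real L powr (2 - \<alpha>)"
  have bounds: "(2 * s - 3 * E L) * (1 - C * \<delta> L) - real L powr (\<alpha> - 1) \<le> ?P L \<and>
      ?P L \<le> (2 * s + 3 * E L) * (1 + C * \<delta> L)"
    if L: "s * real L powr (-\<alpha>) < 1 / 2" "C * \<delta> L < 1" "0 < L"
      "\<forall>b<M L. real (cell_count x L (M L) b) \<le> C * real L / real (M L)" for L
  proof -
    define W where "W = real L powr (2 - \<alpha>)"
    define A where "A = real L powr \<alpha>"
    have W: "0 < W" and A: "0 < A" using L by (auto simp: W_def A_def)
    have AW: "A * W = (real L)\<^sup>2"
      using L by (simp add: A_def W_def powr_add[symmetric] powr_realpow flip: powr_numeral)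
    have LW: "real L / W = real L powr (\<alpha> - 1)"
      using L powr_diff[of "real L" 1 "2 - \<alpha>"] by (simp add: W_def)
    define r where "r = s / A"
    have rs: "r = s * real L powr (-\<alpha>)" by (simp add: r_def A_def powr_minus divide_inverse)
    have r: "0 \<le> r" "r \<le> 1 / 2" using s A L(1) rs by (auto simp: r_def)
    have dd: "discrepancy x L (M L) = \<delta> L * real L" using L(3) by (simp add: \<delta>_def)
    have q1: "(real L)\<^sup>2 / real (M L) + C * real L / real (M L) * discrepancy x L (M L)
        = (real L)\<^sup>2 / real (M L) * (1 + C * \<delta> L)"
      and q2: "(real L)\<^sup>2 / real (M L) - C * real L / real (M L) * discrepancy x L (M L)
        = (real L)\<^sup>2 / real (M L) * (1 - C * \<delta> L)"
      unfolding dd using M[of L] by (simp_all add: field_simps power2_eq_square)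
    have f1: "(2 * (r * real (M L)) + 3) * ((real L)\<^sup>2 / real (M L)) = (2 * s + 3 * E L) * W"
     and f2: "(2 * (r * real (M L)) - 3) * ((real L)\<^sup>2 / real (M L)) = (2 * s - 3 * E L) * W"
      unfolding AW[symmetric] E_def r_def A_def[symmetric] using M[of L] A by (simp_all add: field_simps)
    have "real (card (close_pairs x L r)) \<le> ((2 * s + 3 * E L) * W) * (1 + C * \<delta> L)"
      unfolding f1[symmetric] mult.assoc q1[symmetric]
      by (rule card_close_pairs_le) (use x M r L C(2) in auto)
    then have up: "real (card (close_pairs x L r)) / W \<le> (2 * s + 3 * E L) * (1 + C * \<delta> L)"
      using W by (simp add: field_simps)
    have "((2 * s - 3 * E L) * W) * (1 - C * \<delta> L) \<le> real (card (close_pairs x L r)) + real L"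
      unfolding f2[symmetric] mult.assoc q2[symmetric]
    proof (rule card_close_pairs_ge)
      show "0 \<le> (real L)\<^sup>2 / real (M L) - C * real L / real (M L) * discrepancy x L (M L)"
        unfolding q2 using L by simp
    qed (use x M r L in auto)
    then have "(2 * s - 3 * E L) * (1 - C * \<delta> L) \<le> real (card (close_pairs x L r)) / W + real L / W"
      using W by (simp add: field_simps)
    then show ?thesis using up by (simp add: LW[unfolded W_def] r_def A_def W_def)
  qed
  have "?P \<longlonglongrightarrow> 2 * s"
  proof (rule tendsto_sandwich)
    show "eventually (\<lambda>L. (2 * s - 3 * E L) * (1 - C * \<delta> L) - real L powr (\<alpha> - 1) \<le> ?P L) sequentially"
      using ev by eventually_elim (use bounds in blast)
    show "eventually (\<lambda>L. ?P L \<le> (2 * s + 3 * E L) * (1 + C * \<delta> L)) sequentially"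
      using ev by eventually_elim (use bounds in blast)
    have "(\<lambda>L. (2 * s - 3 * E L) * (1 - C * \<delta> L) - real L powr (\<alpha> - 1))
        \<longlonglongrightarrow> (2 * s - 3 * 0) * (1 - C * 0) - 0"
      by (intro tendsto_intros lim p)
    then show "(\<lambda>L. (2 * s - 3 * E L) * (1 - C * \<delta> L) - real L powr (\<alpha> - 1)) \<longlonglongrightarrow> 2 * s" by simp
    have "(\<lambda>L. (2 * s + 3 * E L) * (1 + C * \<delta> L)) \<longlonglongrightarrow> (2 * s + 3 * 0) * (1 + C * 0)"
      by (intro tendsto_intros lim)
    then show "(\<lambda>L. (2 * s + 3 * E L) * (1 + C * \<delta> L)) \<longlonglongrightarrow> 2 * s" by simp
  qed
  then show "(\<lambda>N. real (card {(i, j). i \<in> {1..N} \<and> j \<in> {1..N} \<and> i \<noteq> j \<and>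
                    nearest_int_dist (x i - x j) \<le> s / real N powr \<alpha>})
              / real N powr (2 - \<alpha>)) \<longlonglongrightarrow> 2 * s"
    by (simp add: close_pairs_def)
qed

section \<open>Stratification\<close>

definition stratified :: "(nat \<Rightarrow> real) \<Rightarrow> nat \<Rightarrow> bool" where
  "stratified x N \<longleftrightarrow> (\<forall>i\<in>{1..N}. 0 \<le> x i \<and> x i < 1) \<and>
     bij_betw (\<lambda>i. cell N (x i)) {1..N} {..<N}"

lemma free_cells_eq:
  assumes "\<forall>i\<in>{1..N}. 0 \<le> x i" "0 < N"
  shows "free_cells x N = {..<2 * N} - (\<lambda>i. cell (2 * N) (x i)) ` {1..N}"
proof -
  have "x i \<in> {real m / real (2 * N)..<real (m + 1) / real (2 * N)} \<longleftrightarrow> cell (2 * N) (x i) = m"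
    if "i \<in> {1..N}" for i m
    using assms that by (subst cell_eq_iff) (auto simp: field_simps)
  then show ?thesis unfolding free_cells_def by (auto simp: lessThan_atLeast0)
qed

text \<open>The cell \<open>c\<close> at scale \<open>N\<close> has the halves \<open>2 * c\<close>
  and \<open>2 * c + 1\<close>, and its single point occupies exactly one of them. Hence
  \<open>e c\<close>, the other half, enumerates the free cells in increasing order.\<close>

lemma free_cells_enumeration:
  assumes "stratified x N" "0 < N"
  obtains e where "\<And>c. e c div 2 = c" "strict_mono e" "free_cells x N = e ` {..<N}"
    "sorted_list_of_set (free_cells x N) = map e [0..<N]"
proof -
  define S where "S = (\<lambda>i. cell (2 * N) (x i)) ` {1..N}"
  define e where "e c = (if 2 * c \<in> S then 2 * c + 1 else 2 * c)" for c
  have x: "\<forall>i\<in>{1..N}. 0 \<le> x i" and bij: "bij_betw (\<lambda>i. cell N (x i)) {1..N} {..<N}"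
    using assms by (auto simp: stratified_def)
  have div: "cell (2 * N) (x i) div 2 = cell N (x i)" if "i \<in> {1..N}" for i
    using cell_mult_div[of "x i" 2 N] x that by (simp add: mult.commute)
  have ediv: "e c div 2 = c" for c by (simp add: e_def)
  have mono: "strict_mono e" by (rule strict_monoI) (auto simp: e_def)
  have one: "2 * c \<in> S \<longleftrightarrow> 2 * c + 1 \<notin> S" if "c < N" for c
  proof
    assume "2 * c \<in> S"
    then obtain i where i: "i \<in> {1..N}" "cell (2 * N) (x i) = 2 * c" by (auto simp: S_def)
    show "2 * c + 1 \<notin> S"
    proof
      assume "2 * c + 1 \<in> S"
      then obtain j where j: "j \<in> {1..N}" "cell (2 * N) (x j) = 2 * c + 1" by (auto simp: S_def)
      have "cell N (x i) = cell N (x j)" using div[OF i(1)] div[OF j(1)] i j by simp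
      then have "i = j" using inj_onD[OF bij_betw_imp_inj_on[OF bij]] i j by blast
      then show False using i j by simp
    qed
  next
    assume n: "2 * c + 1 \<notin> S"
    have "c \<in> (\<lambda>i. cell N (x i)) ` {1..N}"
      unfolding bij_betw_imp_surj_on[OF bij] using that by simp
    then obtain i where i: "i \<in> {1..N}" "cell N (x i) = c" by blast
    then have "cell (2 * N) (x i) \<in> S" "cell (2 * N) (x i) div 2 = c"
      using div by (auto simp: S_def)
    moreover from this have "cell (2 * N) (x i) = 2 * c \<or> cell (2 * N) (x i) = 2 * c + 1" by presburger
    ultimately show "2 * c \<in> S" using n by auto
  qed
  have free: "free_cells x N = {..<2 * N} - S"
    unfolding S_def by (rule free_cells_eq) (use x assms in auto)
  have eq: "free_cells x N = e ` {..<N}"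
  proof (rule set_eqI)
    fix m
    show "m \<in> free_cells x N \<longleftrightarrow> m \<in> e ` {..<N}"
    proof
      assume m: "m \<in> free_cells x N"
      define c where "c = m div 2"
      have "c < N" "m = 2 * c \<or> m = 2 * c + 1" using m by (auto simp: free c_def)
      then have "m = e c" using m one[of c] by (auto simp: free e_def)
      then show "m \<in> e ` {..<N}" using \<open>c < N\<close> by auto
    next
      assume "m \<in> e ` {..<N}"
      then obtain c where "c < N" "m = e c" by auto
      then show "m \<in> free_cells x N" using one[of c] by (auto simp: free e_def)
    qed
  qed
  have "sorted (map e [0..<N])"
    by (auto simp: sorted_iff_nth_mono strict_mono_less_eq[OF mono])
  moreover have "distinct (map e [0..<N])"
    using strict_mono_eq[OF mono] by (auto simp: distinct_map inj_on_def)
  moreover have "set (map e [0..<N]) = free_cells x N"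
    unfolding eq by (simp add: lessThan_atLeast0)
  ultimately have "sorted_list_of_set (free_cells x N) = map e [0..<N]"
    by (metis sorted_list_of_set.idem_if_sorted_distinct)
  then show ?thesis using that ediv mono eq by blast
qed

text \<open>The new point \<open>N + k\<close> lies in the free half of the cell
  \<open>p k - 1\<close>, where the 1 is subtracted because permutations act on
  \<open>{1..N}\<close> and cells start at 0. Old points fill the occupied halves and new points the
  free ones. At scale \<open>N\<close> the position of a new point thus depends on the permutation
  only.\<close>

lemma stratified_double:
  assumes s: "stratified x N" and N: "0 < N" and p: "p permutes {1..N}"
    and u: "\<And>k. k \<in> {1..N} \<Longrightarrow> 0 \<le> u k \<and> u k < 1"
    and new: "\<And>k. k \<in> {1..N} \<Longrightarrow> x (N + k) = free_left x N (p k) + u k / real (2 * N)"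
  shows "stratified x (2 * N)" "\<And>k. k \<in> {1..N} \<Longrightarrow> cell N (x (N + k)) = p k - 1"
proof -
  obtain e where e: "\<And>c. e c div 2 = c" "strict_mono e" "free_cells x N = e ` {..<N}"
    "sorted_list_of_set (free_cells x N) = map e [0..<N]"
    using free_cells_enumeration[OF s N] by metis
  have x: "\<forall>i\<in>{1..N}. 0 \<le> x i \<and> x i < 1" and bij: "bij_betw (\<lambda>i. cell N (x i)) {1..N} {..<N}"
    using s by (auto simp: stratified_def)
  have pk: "p k \<in> {1..N}" if "k \<in> {1..N}" for k
    using p that by (simp add: permutes_in_image del: atLeastAtMost_iff)
  have el: "e c < 2 * N" if "c < N" for c using e(1)[of c] that by linarith
  have left: "x (N + k) = (real (e (p k - 1)) + u k) / real (2 * N)" if "k \<in> {1..N}" for k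
  proof -
    have "p k - 1 < N" using pk[OF that] by auto
    then show ?thesis using new[OF that] by (simp add: free_left_def e(4) add_divide_distrib)
  qed
  have pos: "0 \<le> x (N + k)" and lt1: "x (N + k) < 1" if "k \<in> {1..N}" for k
  proof -
    have "p k - 1 < N" using pk[OF that] by auto
    then have "real (e (p k - 1)) + 1 \<le> real (2 * N)" using el by (metis Suc_eq_plus1 Suc_leI of_nat_1 of_nat_add of_nat_le_iff)
    then show "0 \<le> x (N + k)" "x (N + k) < 1"
      unfolding left[OF that] using u[OF that] N by (auto simp: field_simps)
  qed
  have c2: "cell (2 * N) (x (N + k)) = e (p k - 1)" if "k \<in> {1..N}" for k
    using pos[OF that] u[OF that] N left[OF that] by (subst cell_eq_iff) auto
  show c1: "cell N (x (N + k)) = p k - 1" if "k \<in> {1..N}" for k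
    using cell_mult_div[of "x (N + k)" 2 N] pos[OF that] c2[OF that] e(1) by (simp add: mult.commute)
  have split: "{1..2 * N} = {1..N} \<union> (\<lambda>k. N + k) ` {1..N}"
    unfolding image_add_atLeastAtMost by auto
  have old: "bij_betw (\<lambda>i. cell (2 * N) (x i)) {1..N} ((\<lambda>i. cell (2 * N) (x i)) ` {1..N})"
  proof (rule inj_on_imp_bij_betw, rule inj_onI)
    fix i j assume ij: "i \<in> {1..N}" "j \<in> {1..N}" "cell (2 * N) (x i) = cell (2 * N) (x j)"
    then have "cell N (x i) = cell N (x j)"
      using cell_mult_div[of "x i" 2 N] cell_mult_div[of "x j" 2 N] x by (simp add: mult.commute)
    then show "i = j" using inj_onD[OF bij_betw_imp_inj_on[OF bij]] ij by blast
  qed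
  have shift: "bij_betw (\<lambda>i. i - N) ((\<lambda>k. N + k) ` {1..N}) {1..N}"
    by (rule bij_betwI[where g = "\<lambda>k. N + k"]) auto
  have pred: "bij_betw (\<lambda>k. k - 1) {1..N} {..<N}"
    by (rule bij_betwI[where g = Suc]) auto
  have "bij_betw e {..<N} (free_cells x N)"
    unfolding e(3) by (intro inj_on_imp_bij_betw strict_mono_imp_inj_on[OF e(2), THEN inj_on_subset]) auto
  then have "bij_betw (e \<circ> ((\<lambda>k. k - 1) \<circ> (p \<circ> (\<lambda>i. i - N)))) ((\<lambda>k. N + k) ` {1..N}) (free_cells x N)"
    by (intro bij_betw_trans[OF bij_betw_trans[OF bij_betw_trans[OF shift permutes_imp_bij[OF p]] pred]])
  then have new': "bij_betw (\<lambda>i. cell (2 * N) (x i)) ((\<lambda>k. N + k) ` {1..N}) (free_cells x N)"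
    by (rule bij_betw_cong[THEN iffD1, rotated]) (auto simp: c2 simp del: image_add_atLeastAtMost)
  have free: "free_cells x N = {..<2 * N} - (\<lambda>i. cell (2 * N) (x i)) ` {1..N}"
    by (rule free_cells_eq) (use x N in auto)
  have "bij_betw (\<lambda>i. cell (2 * N) (x i)) ({1..N} \<union> (\<lambda>k. N + k) ` {1..N})
      ((\<lambda>i. cell (2 * N) (x i)) ` {1..N} \<union> free_cells x N)"
    by (rule bij_betw_combine[OF old new']) (auto simp: free)
  moreover have "(\<lambda>i. cell (2 * N) (x i)) ` {1..N} \<subseteq> {..<2 * N}"
    using x N by (auto intro!: cell_less)
  then have "(\<lambda>i. cell (2 * N) (x i)) ` {1..N} \<union> free_cells x N = {..<2 * N}"
    by (auto simp: free)
  ultimately have "bij_betw (\<lambda>i. cell (2 * N) (x i)) {1..2 * N} {..<2 * N}" by (simp only: split)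
  moreover have "\<forall>i\<in>{1..2 * N}. 0 \<le> x i \<and> x i < 1"
    unfolding split using x pos lt1 by (auto simp del: image_add_atLeastAtMost)
  ultimately show "stratified x (2 * N)" by (simp add: stratified_def)
qed

lemma stratified_jittered_pair:
  assumes p: "p permutes {1..2}" and u: "\<And>k. k \<in> {1..2} \<Longrightarrow> 0 \<le> u k \<and> u k < 1"
    and x: "\<And>k. k \<in> {1..2} \<Longrightarrow> x k = jittered_point 2 p u k"
  shows "stratified x 2"
proof -
  have pk: "p k \<in> {1..2}" if "k \<in> {1..2}" for k
    using p that by (simp add: permutes_in_image del: atLeastAtMost_iff)
  have x01: "0 \<le> x k \<and> x k < 1" if "k \<in> {1..2}" for k
    using x[OF that] pk[OF that] u[OF that] by (auto simp: jittered_point_def)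
  have c: "cell 2 (x k) = p k - 1" if "k \<in> {1..2}" for k
    using x01[OF that] x[OF that] pk[OF that] u[OF that]
    by (subst cell_eq_iff) (auto simp: jittered_point_def of_nat_diff)
  have "bij_betw (\<lambda>k::nat. k - 1) {1..2} {..<2}"
    by (rule bij_betwI[where g = Suc]) auto
  then have "bij_betw ((\<lambda>k. k - 1) \<circ> p) {1..2} {..<2}"
    by (rule bij_betw_trans[OF permutes_imp_bij[OF p]])
  then have "bij_betw (\<lambda>k. cell 2 (x k)) {1..2} {..<2}"
    by (rule bij_betw_cong[THEN iffD1, rotated]) (auto simp: c)
  then show ?thesis using x01 by (simp add: stratified_def)
qed

lemma sequential_jittering_stratified:
  assumes seq: "sequential_jittering p u x"
    and p: "\<And>n. p n permutes {1..step_size n}"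
    and u: "\<And>i. 1 \<le> i \<Longrightarrow> 0 \<le> u i \<and> u i < 1"
  shows "1 \<le> n \<Longrightarrow> stratified x (2 ^ n)"
    "1 \<le> n \<Longrightarrow> k \<in> {1..2 ^ n} \<Longrightarrow> cell (2 ^ n) (x (2 ^ n + k)) = p n k - 1"
    "1 \<le> i \<Longrightarrow> 0 \<le> x i \<and> x i < 1"
proof -
  have new: "x (2 ^ n + k) = free_left x (2 ^ n) (p n k) + u (2 ^ n + k) / real (2 * 2 ^ n)"
    if "1 \<le> n" "k \<in> {1..2 ^ n}" for n k
    using seq that unfolding sequential_jittering_def by blast
  have perm: "p n permutes {1..2 ^ n}" if "1 \<le> n" for n
    using p[of n] that by (simp add: step_size_def)
  show st: "stratified x (2 ^ n)" if "1 \<le> n" for n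
    using that
  proof (induction n rule: dec_induct)
    case base
    show ?case
      using stratified_jittered_pair[of "p 0" u x] p[of 0] u seq
      by (auto simp: step_size_def sequential_jittering_def)
  next
    case (step n)
    show ?case
      using stratified_double(1)[of x "2 ^ n" "p n" "\<lambda>k. u (2 ^ n + k)"] step perm[of n] u new[of n]
      by simp
  qed
  show "cell (2 ^ n) (x (2 ^ n + k)) = p n k - 1" if "1 \<le> n" "k \<in> {1..2 ^ n}"
    using stratified_double(2)[of x "2 ^ n" "p n" "\<lambda>k. u (2 ^ n + k)" k] st[of n] that perm[of n] u new[of n]
    by simp
  \<comment> \<open>Since \<open>i < 2 ^ i\<close>, the point \<open>i\<close> is among the first
    \<open>2 ^ i\<close>, which are stratified.\<close>
  show "0 \<le> x i \<and> x i < 1" if "1 \<le> i"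
    using st[of i] that less_exp[of i] by (auto simp: stratified_def)
qed

section \<open>Failure of Poissonian pair correlations\<close>

text \<open>The left-hand side would tend to \<open>2 + 1 / 2\<close> under Poissonian pair
  correlations. It is bounded by counting, for each radius, twice the short gaps, and by weighing
  short gaps against the total gap length 1.\<close>

lemma stratified_not_close:
  assumes s: "stratified x N" and N: "0 < N"
  shows "real (card (close_pairs x N (1 / real N))) / real N
    + real (card (close_pairs x N (1 / 2 / real N))) / (2 * real N) \<le> 2"
proof -
  have x: "0 \<le> x i" "x i < 1" if "i \<in> {1..N}" for i using s that by (auto simp: stratified_def)
  have bij: "bij_betw (\<lambda>i. cell N (x i)) {1..N} {..<N}" using s by (auto simp: stratified_def)
  \<comment> \<open>\<open>\<sigma> c\<close> is the index of the point in cell \<open>c\<close>,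
    \<open>nxt\<close> the cyclic successor, and \<open>g c\<close> the gap from the point in cell
    \<open>c\<close> to the next one. The last gap passes through 1, hence the added 1.\<close>
  define \<sigma> where "\<sigma> = the_inv_into {1..N} (\<lambda>i. cell N (x i))"
  define nxt where "nxt c = (if c = N - 1 then 0 else Suc c)" for c
  define g where "g c = x (\<sigma> (nxt c)) - x (\<sigma> c) + (if c = N - 1 then 1 else 0)" for c
  have \<sigma>: "\<sigma> c \<in> {1..N}" "cell N (x (\<sigma> c)) = c" if "c < N" for c
  proof -
    have c: "c \<in> (\<lambda>i. cell N (x i)) ` {1..N}"
      unfolding bij_betw_imp_surj_on[OF bij] using that by simp
    show "\<sigma> c \<in> {1..N}" "cell N (x (\<sigma> c)) = c"
      unfolding \<sigma>_def using the_inv_into_into[OF bij_betw_imp_inj_on[OF bij] c subset_refl]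
        f_the_inv_into_f[OF bij_betw_imp_inj_on[OF bij] c] by auto
  qed
  have \<sigma>_cell: "\<sigma> (cell N (x i)) = i" if "i \<in> {1..N}" for i
    unfolding \<sigma>_def by (rule the_inv_into_f_f[OF bij_betw_imp_inj_on[OF bij] that])
  have nxt: "nxt c < N" if "c < N" for c using that by (auto simp: nxt_def)
  have g_upper: "real N * g c \<le> 2" if c: "c < N" for c
  proof -
    have "real N * g c = real N * x (\<sigma> (nxt c)) - real N * x (\<sigma> c) + (if c = N - 1 then real N else 0)"
      by (simp add: g_def algebra_simps)
    moreover have "real (nxt c) + (if c = N - 1 then real N else 0) = real c + 1"
      using N by (auto simp: nxt_def of_nat_diff)
    ultimately show ?thesis
      using cell_bounds[OF x(1)[OF \<sigma>(1)[OF c]], of N]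
        cell_bounds[OF x(1)[OF \<sigma>(1)[OF nxt[OF c]]], of N] \<sigma>(2)[OF c] \<sigma>(2)[OF nxt[OF c]]
      by auto
  qed
  \<comment> \<open>Summing the gaps cancels all points, because \<open>nxt\<close> permutes the
    cells; only the 1 of the wrap-around remains.\<close>
  have "bij_betw nxt {..<N} {..<N}"
    by (rule bij_betwI[where g = "\<lambda>c. if c = 0 then N - 1 else c - 1"])
      (use N in \<open>auto simp: nxt_def\<close>)
  then have "(\<Sum>c<N. x (\<sigma> (nxt c))) = (\<Sum>c<N. x (\<sigma> c))"
    by (rule sum.reindex_bij_betw)
  moreover have "(\<Sum>c<N. if c = N - 1 then 1 else 0) = (1::real)" using N by (simp add: sum.delta)
  ultimately have g_sum: "(\<Sum>c<N. g c) = 1"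
    by (simp add: g_def sum.distrib sum_subtractf)
  have count: "real (card (close_pairs x N r)) \<le> 2 * (\<Sum>c<N. if g c \<le> r then 1 else 0)"
    if r: "r * real N \<le> 1" for r
  proof -
    let ?A = "{c \<in> {..<N}. g c \<le> r}"
    have near: "\<exists>c\<in>?A. i = \<sigma> c \<and> j = \<sigma> (nxt c)"
      if ij: "i \<in> {1..N}" "j \<in> {1..N}" and k: "\<bar>x i - x j - of_int k\<bar> \<le> r"
        and pos: "int (cell N (x j)) - int (cell N (x i)) + k * int N = 1" for i j k
    proof -
      let ?c = "cell N (x i)" and ?d = "cell N (x j)"
      have cd: "?c < N" "?d < N" using cell_less x ij N by auto
      \<comment> \<open>A cell difference of 1 leaves no freedom for \<open>k\<close>: it is 1 if
        \<open>i\<close> lies in the last cell, so that \<open>j\<close> lies in cell 0, and 0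
        otherwise.\<close>
      have kk: "k = (if ?c = N - 1 then 1 else 0) \<and> ?d = nxt ?c"
      proof (cases "?c = N - 1")
        case True
        then have d: "int ?d = (1 - k) * int N" using pos N by (simp add: algebra_simps of_nat_diff)
        have "(1 - k) * int N < 1 * int N" unfolding d[symmetric] using cd by simp
        then have "1 - k < 1" using N by (metis mult_less_cancel_right_pos of_nat_0_less_iff)
        moreover have "0 \<le> (1 - k) * int N" unfolding d[symmetric] by simp
        then have "0 \<le> 1 - k" using N by (simp add: zero_le_mult_iff)
        ultimately have "k = 1" by linarith
        then show ?thesis using True d by (simp add: nxt_def)
      next
        case False
        then have "\<bar>k * int N\<bar> < 1 * int N" using pos cd by auto
        then have "\<bar>k\<bar> < 1" using N by (simp add: abs_mult)
        then show ?thesis using pos False by (auto simp: nxt_def)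
      qed
      then have "g ?c = x j - x i + of_int k"
        using \<sigma>_cell[OF ij(1)] \<sigma>_cell[OF ij(2)] by (auto simp: g_def)
      then have "g ?c \<le> r" using k by linarith
      then show ?thesis using cd kk \<sigma>_cell ij by (metis (mono_tags, lifting) lessThan_iff mem_Collect_eq)
    qed
    have "close_pairs x N r \<subseteq> (\<lambda>c. (\<sigma> c, \<sigma> (nxt c))) ` ?A \<union> (\<lambda>c. (\<sigma> (nxt c), \<sigma> c)) ` ?A"
    proof clarify
      fix i j assume "(i, j) \<in> close_pairs x N r" and n: "(i, j) \<notin> (\<lambda>c. (\<sigma> (nxt c), \<sigma> c)) ` ?A"
      then have ij: "i \<in> {1..N}" "j \<in> {1..N}" "i \<noteq> j" and "nearest_int_dist (x i - x j) \<le> r"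
        by (auto simp: close_pairs_def)
      then obtain k :: int where k: "\<bar>x i - x j - of_int k\<bar> \<le> r"
        by (auto simp: nearest_int_dist_le_iff)
      let ?c = "cell N (x i)" and ?d = "cell N (x j)"
      have cd: "?c < N" "?d < N" using cell_less x ij N by auto
      \<comment> \<open>By the floor argument \<open>\<bar>t\<bar> < 2\<close>. The value 0 would
        put both points in the same cell, and 1 and -1 are the two orders of a cyclically adjacent
        pair.\<close>
      define t where "t = int ?d - int ?c + k * int N"
      have "real N * \<bar>x i - x j - of_int k\<bar> \<le> real N * r" using k by (intro mult_left_mono) auto
      then have "\<bar>real N * (x i - x j - of_int k)\<bar> \<le> 1" using r by (simp add: abs_mult mult.commute)
      moreover have "real N * (x i - x j - of_int k) = real N * x i - real N * x j - real N * of_int k"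
        by (simp add: right_diff_distrib)
      moreover have "of_int t = real ?d - real ?c + real N * of_int k" by (simp add: t_def)
      ultimately have "\<bar>real_of_int t\<bar> < 2"
        using cell_bounds[OF x(1)[OF ij(1)], of N] cell_bounds[OF x(1)[OF ij(2)], of N] by linarith
      then have "t = 0 \<or> t = 1 \<or> t = -1" by linarith
      moreover have "t \<noteq> 0"
      proof
        assume t0: "t = 0"
        then have "int N dvd int ?c - int ?d" unfolding t_def by (metis diff_eq_eq diff_add_eq dvd_triv_right add_0 diff_diff_eq2)
        then have "?c = ?d" using cd by (metis cong_def mod_eq_dvd_iff mod_less of_nat_eq_iff of_nat_mod)
        then show False using \<sigma>_cell ij by metis
      qed
      moreover have "t \<noteq> -1"
      proof
        assume "t = -1"
        then have "\<exists>c\<in>?A. j = \<sigma> c \<and> i = \<sigma> (nxt c)"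
          using near[of j i "-k"] ij k by (simp add: t_def abs_le_iff)
        then show False using n by blast
      qed
      ultimately have "\<exists>c\<in>?A. i = \<sigma> c \<and> j = \<sigma> (nxt c)"
        using near[of i j k] ij k by (simp add: t_def)
      then show "(i, j) \<in> (\<lambda>c. (\<sigma> c, \<sigma> (nxt c))) ` ?A" by blast
    qed
    then have "card (close_pairs x N r)
        \<le> card ((\<lambda>c. (\<sigma> c, \<sigma> (nxt c))) ` ?A \<union> (\<lambda>c. (\<sigma> (nxt c), \<sigma> c)) ` ?A)"
      by (intro card_mono) auto
    also have "\<dots> \<le> card ((\<lambda>c. (\<sigma> c, \<sigma> (nxt c))) ` ?A) + card ((\<lambda>c. (\<sigma> (nxt c), \<sigma> c)) ` ?A)"
      by (rule card_Un_le)
    also have "\<dots> \<le> card ?A + card ?A" by (intro add_mono card_image_le) auto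
    finally have "card (close_pairs x N r) \<le> 2 * card ?A" by simp
    moreover have "(\<Sum>c<N. if g c \<le> r then 1 else (0::real)) = real (card ?A)"
      by (simp add: sum.If_cases Int_def conj_commute)
    ultimately show ?thesis by linarith
  qed
  \<comment> \<open>A step function above the scaled gap: 2 in general, 1 for gaps up to
    \<open>1 / N\<close>, and \<open>1 / 2\<close> for gaps up to
    \<open>1 / (2 * N)\<close>.\<close>
  have pt: "real N * g c \<le> 2 - (if g c \<le> 1 / real N then 1 else 0) - (if g c \<le> 1 / 2 / real N then 1 else 0) / 2"
    if "c < N" for c
  proof -
    have "1 / 2 / real N \<le> 1 / real N" using N by (simp add: field_simps)
    moreover have "g c \<le> 1 / real N \<Longrightarrow> real N * g c \<le> 1" "g c \<le> 1 / 2 / real N \<Longrightarrow> real N * g c \<le> 1 / 2"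
      using N by (simp_all add: field_simps)
    ultimately show ?thesis using g_upper[OF that] by auto
  qed
  have "real N = (\<Sum>c<N. real N * g c)" by (simp add: sum_distrib_left[symmetric] g_sum)
  also have "\<dots> \<le> (\<Sum>c<N. 2 - (if g c \<le> 1 / real N then 1 else 0) - (if g c \<le> 1 / 2 / real N then 1 else 0) / 2)"
    by (intro sum_mono pt) simp
  also have "\<dots> = 2 * real N - (\<Sum>c<N. if g c \<le> 1 / real N then 1 else 0)
      - (\<Sum>c<N. if g c \<le> 1 / 2 / real N then 1 else 0) / 2"
    by (simp add: sum_subtractf sum_divide_distrib)
  finally have "real (card (close_pairs x N (1 / real N))) / 2
      + real (card (close_pairs x N (1 / 2 / real N))) / 4 \<le> real N"
    using count[of "1 / real N"] count[of "1 / 2 / real N"] N by simp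
  then show ?thesis using N by (simp add: field_simps)
qed

text \<open>Along the powers of two, the limits for \<open>s = 1\<close> and
  \<open>s = 1 / 2\<close> would combine to \<open>5 / 2\<close>, against the bound 2 of
  \<open>stratified_not_close\<close>.\<close>

lemma not_ppc_if_stratified:
  assumes "\<And>n. 1 \<le> n \<Longrightarrow> stratified x (2 ^ n)"
  shows "\<not> ppc x"
proof
  assume "ppc x"
  then have lim: "(\<lambda>N. real (card (close_pairs x N (s / real N))) / real N) \<longlonglongrightarrow> 2 * s" if "0 \<le> s" for s
    using that unfolding ppc_def alpha_ppc_def close_pairs_def by simp
  have sub: "filterlim (\<lambda>n. 2 ^ n :: nat) sequentially sequentially"
    by (rule filterlim_subseq) (simp add: strict_mono_def)
  have "(\<lambda>N. real (card (close_pairs x N (1 / real N))) / real N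
      + real (card (close_pairs x N (1 / 2 / real N))) / real N / 2) \<longlonglongrightarrow> 2 * 1 + 2 * (1 / 2) / 2"
    by (intro tendsto_intros lim) auto
  from filterlim_compose[OF this sub]
  have "(\<lambda>n. real (card (close_pairs x (2 ^ n) (1 / real (2 ^ n)))) / real (2 ^ n)
      + real (card (close_pairs x (2 ^ n) (1 / 2 / real (2 ^ n)))) / real (2 ^ n) / 2) \<longlonglongrightarrow> 5 / 2"
    by simp
  then have "(5 :: real) / 2 \<le> 2"
  proof (rule LIMSEQ_le_const2, intro exI[of _ 1] allI impI)
    fix n :: nat assume "1 \<le> n"
    then show "real (card (close_pairs x (2 ^ n) (1 / real (2 ^ n)))) / real (2 ^ n)
      + real (card (close_pairs x (2 ^ n) (1 / 2 / real (2 ^ n)))) / real (2 ^ n) / 2 \<le> 2"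
      using stratified_not_close[OF assms, of n] by (simp add: mult.commute)
  qed
  then show False by simp
qed

section \<open>Random permutations\<close>

text \<open>Composition with a transposition is an involution on the permutations of
  \<open>S\<close>. This is the exchangeability of the values of a uniform permutation.\<close>

lemma sum_permutations_transpose:
  fixes F :: "('a \<Rightarrow> 'a) \<Rightarrow> real"
  assumes "a \<in> S" "b \<in> S"
  shows "(\<Sum>p | p permutes S. F (p \<circ> Transposition.transpose a b)) = (\<Sum>p | p permutes S. F p)"
proof (rule sum.reindex_bij_betw)
  show "bij_betw (\<lambda>p. p \<circ> Transposition.transpose a b) {p. p permutes S} {p. p permutes S}"
    using assms by (intro bij_betwI[where g = "\<lambda>p. p \<circ> Transposition.transpose a b"])
      (auto simp: comp_assoc intro: permutes_compose permutes_swap_id)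
qed

text \<open>The values at distinct points are negatively correlated, because the sum over all
  points is constant.\<close>

lemma sum_permutations_square_le:
  fixes f :: "'a \<Rightarrow> real"
  assumes S: "finite S" and zero: "(\<Sum>s\<in>S. f s) = 0" and K: "A \<subseteq> S"
  shows "(\<Sum>p | p permutes S. (\<Sum>k\<in>A. f (p k))\<^sup>2) \<le> (\<Sum>p | p permutes S. \<Sum>s\<in>S. (f s)\<^sup>2)"
proof -
  define P where "P = {p. p permutes S}"
  \<comment> \<open>Up to the factor \<open>1 / fact (card S)\<close>, \<open>c k l\<close> is the
    covariance of the values at \<open>k\<close> and \<open>l\<close>.\<close>
  define c where "c k l = (\<Sum>p\<in>P. f (p k) * f (p l))" for k l
  have fin: "finite A" using K S finite_subset by blast
  have swap: "c (Transposition.transpose a b k) (Transposition.transpose a b l) = c k l" if "a \<in> S" "b \<in> S" for a b k l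
    using sum_permutations_transpose[OF that, of "\<lambda>p. f (p k) * f (p l)"] by (simp add: c_def P_def)
  have row: "(\<Sum>l\<in>S. c k l) = 0" for k
  proof -
    have "(\<Sum>l\<in>S. c k l) = (\<Sum>p\<in>P. f (p k) * (\<Sum>l\<in>S. f (p l)))"
      unfolding c_def by (subst sum.swap) (simp add: sum_distrib_left)
    also have "\<dots> = (\<Sum>p\<in>P. f (p k) * 0)"
    proof (intro sum.cong refl)
      fix p assume "p \<in> P"
      then have "(\<Sum>l\<in>S. f (p l)) = (\<Sum>l\<in>S. f l)"
        by (intro sum.reindex_bij_betw permutes_imp_bij) (simp add: P_def)
      then show "f (p k) * (\<Sum>l\<in>S. f (p l)) = f (p k) * 0" by (simp add: zero)
    qed
    finally show ?thesis by simp
  qed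
  have diag_nonneg: "0 \<le> c k k" for k unfolding c_def by (intro sum_nonneg) auto
  \<comment> \<open>By exchangeability all off-diagonal entries of row \<open>k\<close> agree. The
    row sums to 0 and its diagonal entry is nonnegative, so the common value is nonpositive.\<close>
  have off: "c k l \<le> 0" if kl: "k \<in> S" "l \<in> S" "k \<noteq> l" for k l
  proof -
    have same: "c k m = c k l" if "m \<in> S - {k}" for m
      using swap[of l m k l] kl that by auto
    have "0 = c k k + (\<Sum>m\<in>S - {k}. c k m)"
      using row[of k] S kl by (simp add: sum.remove)
    also have "\<dots> = c k k + real (card (S - {k})) * c k l" by (simp add: same)
    finally have "real (card (S - {k})) * c k l \<le> 0" using diag_nonneg[of k] by linarith
    moreover have "S - {k} \<noteq> {}" using kl by blast
    then have "0 < real (card (S - {k}))" using S by (metis card_gt_0_iff finite_Diff of_nat_0_less_iff)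
    ultimately show ?thesis by (metis mult_le_0_iff not_le)
  qed
  have "(\<Sum>p\<in>P. (\<Sum>k\<in>A. f (p k))\<^sup>2) = (\<Sum>k\<in>A. \<Sum>l\<in>A. c k l)"
    unfolding c_def power2_eq_square sum_product
    by (subst sum.swap, intro sum.cong refl, subst sum.swap, rule refl)
  also have "\<dots> = (\<Sum>k\<in>A. c k k + (\<Sum>l\<in>A - {k}. c k l))"
    using fin by (intro sum.cong refl) (simp add: sum.remove)
  also have "\<dots> \<le> (\<Sum>k\<in>A. c k k)"
    by (intro sum_mono) (use off K in \<open>auto intro!: sum_nonpos\<close>)
  \<comment> \<open>Enlarging \<open>A\<close> to \<open>S\<close> makes the diagonal sum
    independent of the permutation.\<close>
  also have "\<dots> \<le> (\<Sum>k\<in>S. c k k)"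
    using S K diag_nonneg by (intro sum_mono2) auto
  also have "\<dots> = (\<Sum>p\<in>P. \<Sum>s\<in>S. (f s)\<^sup>2)"
    unfolding c_def
  proof (subst sum.swap, rule sum.cong[OF refl])
    fix p assume "p \<in> P"
    then have "bij_betw p S S" by (intro permutes_imp_bij) (simp add: P_def)
    then show "(\<Sum>k\<in>S. f (p k) * f (p k)) = (\<Sum>s\<in>S. (f s)\<^sup>2)"
      unfolding power2_eq_square by (rule sum.reindex_bij_betw)
  qed
  finally show ?thesis by (simp add: P_def)
qed

text \<open>The count minus its mean is a sum of values of the centred indicator \<open>f\<close>,
  whose squares sum to at most \<open>h = card B\<close>. So the mean square deviation is at most
  \<open>h\<close>, and the mean absolute deviation at most \<open>sqrt h\<close>.\<close>

lemma sum_permutations_count_deviation: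
  assumes S: "finite S" and A: "A \<subseteq> S" and B: "B \<subseteq> S"
  shows "(\<Sum>p | p permutes S. \<bar>real (card {k \<in> A. p k \<in> B}) - real (card A) * real (card B) / real (card S)\<bar>)
    \<le> fact (card S) * sqrt (real (card B))"
proof (cases "B = {}")
  case True
  then show ?thesis by simp
next
  case False
  define h where "h = real (card B)"
  define N where "N = real (card S)"
  define f where "f s = indicator B s - h / N" for s
  have fin: "finite A" "finite B" using A B S finite_subset by blast+
  have h: "0 < h" "h \<le> N"
    using False fin B S by (auto simp: h_def N_def card_gt_0_iff card_mono)
  have ind: "(\<Sum>s\<in>S. indicator B s) = h"
    using B S by (simp add: indicator_def of_bool_def sum.If_cases h_def Int_absorb1)
  have zero: "(\<Sum>s\<in>S. f s) = 0"
    using h by (simp add: f_def sum_subtractf ind N_def[symmetric])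
  have "(\<Sum>s\<in>S. (f s)\<^sup>2) = (\<Sum>s\<in>S. (1 - 2 * (h / N)) * indicator B s + (h / N)\<^sup>2)"
    by (intro sum.cong refl) (auto simp: f_def indicator_def power2_eq_square algebra_simps)
  also have "\<dots> = (1 - 2 * (h / N)) * h + N * (h / N)\<^sup>2"
    by (simp add: sum.distrib sum_distrib_left[symmetric] ind N_def)
  also have "\<dots> = h - h * (h / N)" using h by (simp add: field_simps power2_eq_square)
  also have "\<dots> \<le> h" using h by simp
  finally have sq: "(\<Sum>s\<in>S. (f s)\<^sup>2) \<le> h" .
  have dev: "real (card {k \<in> A. p k \<in> B}) - real (card A) * real (card B) / real (card S) = (\<Sum>k\<in>A. f (p k))" for p
  proof -
    have "(\<Sum>k\<in>A. indicator B (p k)) = (\<Sum>k\<in>A. if p k \<in> B then 1 else (0::real))"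
      by (simp add: indicator_def of_bool_def)
    also have "\<dots> = real (card {k \<in> A. p k \<in> B})"
      using fin by (simp add: sum.If_cases Int_def)
    finally show ?thesis by (simp add: f_def sum_subtractf h_def N_def)
  qed
  \<comment> \<open>Passes from second to first moments; the weight \<open>sqrt h\<close> makes both
    terms contribute \<open>sqrt h / 2\<close> on average.\<close>
  have young: "\<bar>y\<bar> \<le> y\<^sup>2 / (2 * sqrt h) + sqrt h / 2" for y
  proof -
    have "0 \<le> (\<bar>y\<bar> - sqrt h)\<^sup>2" by simp
    then have "2 * sqrt h * \<bar>y\<bar> \<le> y\<^sup>2 + sqrt h * sqrt h"
      by (simp add: power2_eq_square algebra_simps)
    then show ?thesis using h by (simp add: field_simps)
  qed
  have "(\<Sum>p | p permutes S. \<bar>\<Sum>k\<in>A. f (p k)\<bar>)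
      \<le> (\<Sum>p | p permutes S. (\<Sum>k\<in>A. f (p k))\<^sup>2 / (2 * sqrt h) + sqrt h / 2)"
    by (intro sum_mono young)
  also have "\<dots> = (\<Sum>p | p permutes S. (\<Sum>k\<in>A. f (p k))\<^sup>2) / (2 * sqrt h) + fact (card S) * (sqrt h / 2)"
    using S by (simp add: sum.distrib sum_divide_distrib card_permutations)
  also have "\<dots> \<le> (\<Sum>p | p permutes S. \<Sum>s\<in>S. (f s)\<^sup>2) / (2 * sqrt h) + fact (card S) * (sqrt h / 2)"
    using h sum_permutations_square_le[OF S zero A] by (intro add_mono divide_right_mono) auto
  also have "(\<Sum>p | p permutes S. \<Sum>s\<in>S. (f s)\<^sup>2) = fact (card S) * (\<Sum>s\<in>S. (f s)\<^sup>2)"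
    using S by (simp add: card_permutations)
  also have "fact (card S) * (\<Sum>s\<in>S. (f s)\<^sup>2) / (2 * sqrt h) \<le> fact (card S) * h / (2 * sqrt h)"
    using sq h by (intro divide_right_mono mult_left_mono) auto
  also have "fact (card S) * h / (2 * sqrt h) = fact (card S) * (sqrt h / 2)"
    using h real_div_sqrt[of h] by (simp add: field_simps)
  finally show ?thesis by (simp add: dev h_def)
qed

section \<open>Discrepancy at intermediate times\<close>

text \<open>The discrepancy at scale \<open>M\<close> after \<open>K\<close> further points, written
  in terms of the permutation alone. Blocks start at \<open>b * h + 1\<close> because permutations
  act on \<open>{1..M * h}\<close>.\<close>

definition block_deviation :: "nat \<Rightarrow> nat \<Rightarrow> nat \<Rightarrow> (nat \<Rightarrow> nat) \<Rightarrow> real" where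
  "block_deviation M h K p =
     (\<Sum>b<M. \<bar>real (card {k \<in> {1..K}. p k \<in> {b * h + 1..b * h + h}}) - real K / real M\<bar>)"

text \<open>Each of the \<open>M\<close> blocks deviates by at most \<open>sqrt h\<close> on
  average. Relative to the \<open>M * h\<close> points this is \<open>1 / sqrt h\<close>, the gain
  that later gives summability.\<close>

lemma sum_block_deviation_le:
  assumes "0 < M" "0 < h" "K \<le> M * h"
  shows "(\<Sum>p | p permutes {1..M * h}. block_deviation M h K p) \<le> fact (M * h) * (real M * sqrt (real h))"
proof -
  have "(\<Sum>p | p permutes {1..M * h}. \<bar>real (card {k \<in> {1..K}. p k \<in> {b * h + 1..b * h + h}}) - real K / real M\<bar>)
      \<le> fact (M * h) * sqrt (real h)" if "b < M" for b
  proof -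
    have "b * h + h \<le> M * h" using that by (metis Suc_leI add.commute mult_Suc mult_le_mono1)
    then have "{b * h + 1..b * h + h} \<subseteq> {1..M * h}" by auto
    then have "(\<Sum>p | p permutes {1..M * h}. \<bar>real (card {k \<in> {1..K}. p k \<in> {b * h + 1..b * h + h}})
        - real (card {1..K}) * real (card {b * h + 1..b * h + h}) / real (card {1..M * h})\<bar>)
      \<le> fact (card {1..M * h}) * sqrt (real (card {b * h + 1..b * h + h}))"
      by (intro sum_permutations_count_deviation) (use assms in auto)
    then show ?thesis using assms by simp
  qed
  then have "(\<Sum>b<M. \<Sum>p | p permutes {1..M * h}. \<bar>real (card {k \<in> {1..K}. p k \<in> {b * h + 1..b * h + h}}) - real K / real M\<bar>)
      \<le> (\<Sum>b<M. fact (M * h) * sqrt (real h))"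
    by (intro sum_mono) simp
  then show ?thesis
    unfolding block_deviation_def by (subst sum.swap) (simp add: algebra_simps)
qed

text \<open>A cell at scale \<open>M\<close> is a block of \<open>h\<close> cells at scale
  \<open>M * h\<close>, each holding one old point; the new points fall into the block as prescribed
  by \<open>p\<close>.\<close>

lemma cell_count_refinement:
  assumes s: "stratified x (M * h)" and h: "0 < h" "0 < M" and K: "K \<le> M * h" and b: "b < M"
    and x: "\<And>k. k \<in> {1..M * h} \<Longrightarrow> 0 \<le> x (M * h + k) \<and> cell (M * h) (x (M * h + k)) = p k - 1"
    and p: "p permutes {1..M * h}"
  shows "cell_count x (M * h + K) M b = h + card {k \<in> {1..K}. p k \<in> {b * h + 1..b * h + h}}"
proof -
  let ?N = "M * h"
  have bij: "bij_betw (\<lambda>i. cell ?N (x i)) {1..?N} {..<?N}" and x0: "\<forall>i\<in>{1..?N}. 0 \<le> x i"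
    using s by (auto simp: stratified_def)
  have div_iff: "c div h = b \<longleftrightarrow> c \<in> {b * h..<b * h + h}" for c
    using h by (simp add: div_nat_eqI le_less_trans mult.commute)
      (metis add.commute div_nat_eqI dividend_less_times_div le_refl mult.commute mult_Suc_right times_div_less_eq_dividend)
  have bN: "b * h + h \<le> ?N" using b by (metis Suc_leI add.commute mult_Suc mult_le_mono1)
  have "bij_betw (\<lambda>i. cell ?N (x i)) {i \<in> {1..?N}. cell ?N (x i) \<in> {b * h..<b * h + h}} {b * h..<b * h + h}"
    unfolding bij_betw_def
  proof
    show "inj_on (\<lambda>i. cell ?N (x i)) {i \<in> {1..?N}. cell ?N (x i) \<in> {b * h..<b * h + h}}"
      by (rule inj_on_subset[OF bij_betw_imp_inj_on[OF bij]]) blast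
    have "{b * h..<b * h + h} \<subseteq> (\<lambda>i. cell ?N (x i)) ` {1..?N}"
      unfolding bij_betw_imp_surj_on[OF bij] using bN by auto
    then show "(\<lambda>i. cell ?N (x i)) ` {i \<in> {1..?N}. cell ?N (x i) \<in> {b * h..<b * h + h}} = {b * h..<b * h + h}"
      by blast
  qed
  then have "card {i \<in> {1..?N}. cell ?N (x i) \<in> {b * h..<b * h + h}} = card {b * h..<b * h + h}"
    by (rule bij_betw_same_card)
  moreover have "{i \<in> {1..?N}. cell M (x i) = b} = {i \<in> {1..?N}. cell ?N (x i) \<in> {b * h..<b * h + h}}"
  proof (intro Collect_cong conj_cong refl)
    fix i assume "i \<in> {1..?N}"
    then have "cell M (x i) = cell ?N (x i) div h" using cell_mult_div[of "x i" h M] x0 h by simp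
    then show "cell M (x i) = b \<longleftrightarrow> cell ?N (x i) \<in> {b * h..<b * h + h}" by (simp only: div_iff)
  qed
  ultimately have old: "card {i \<in> {1..?N}. cell M (x i) = b} = h" by simp
  have pk: "p k \<in> {1..?N}" if "k \<in> {1..?N}" for k
    using p that by (simp add: permutes_in_image del: atLeastAtMost_iff)
  have iff: "cell M (x (?N + k)) = b \<longleftrightarrow> p k \<in> {b * h + 1..b * h + h}" if "k \<in> {1..K}" for k
  proof -
    have k: "k \<in> {1..?N}" using that K by auto
    have "cell M (x (?N + k)) = (p k - 1) div h"
      using cell_mult_div[of "x (?N + k)" h M] x[OF k] h by simp
    moreover have "p k - 1 \<in> {b * h..<b * h + h} \<longleftrightarrow> p k \<in> {b * h + 1..b * h + h}"
      using pk[OF k] by auto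
    ultimately show ?thesis by (simp only: div_iff)
  qed
  have "{i \<in> {1..?N + K}. cell M (x i) = b}
      = {i \<in> {1..?N}. cell M (x i) = b} \<union> (\<lambda>k. ?N + k) ` {k \<in> {1..K}. cell M (x (?N + k)) = b}"
    (is "?L = ?A \<union> ?B")
  proof (rule set_eqI)
    fix i
    show "i \<in> ?L \<longleftrightarrow> i \<in> ?A \<union> ?B"
    proof (cases "i \<le> ?N")
      case True
      then show ?thesis by auto
    next
      case False
      then obtain k where "i = ?N + k" "0 < k" by (metis less_imp_add_positive not_le)
      then show ?thesis by auto
    qed
  qed
  moreover have "?A \<inter> ?B = {}" by auto
  ultimately have "cell_count x (?N + K) M b
      = card {i \<in> {1..?N}. cell M (x i) = b} + card ((\<lambda>k. ?N + k) ` {k \<in> {1..K}. cell M (x (?N + k)) = b})"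
    unfolding cell_count_def by (simp add: card_Un_disjoint)
  also have "card ((\<lambda>k. ?N + k) ` {k \<in> {1..K}. cell M (x (?N + k)) = b})
      = card {k \<in> {1..K}. cell M (x (?N + k)) = b}"
    by (rule card_image) simp
  also have "{k \<in> {1..K}. cell M (x (?N + k)) = b} = {k \<in> {1..K}. p k \<in> {b * h + 1..b * h + h}}"
    using iff by blast
  finally show ?thesis using old by simp
qed

text \<open>Counts only grow with time. Their total and the total of the expected counts both grow
  by \<open>L - L'\<close>, whence the factor 2.\<close>

lemma discrepancy_mono:
  assumes x: "\<And>i. i \<in> {1..L} \<Longrightarrow> cell M (x i) < M" and "0 < M" and "L' \<le> L"
  shows "discrepancy x L M \<le> discrepancy x L' M + 2 * real (L - L')"
proof -
  have total: "(\<Sum>b<M. real (cell_count x n M b)) = real n" if "n \<le> L" for n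
    using sum_cell_count[of n M x "\<lambda>_. 1"] x that by simp
  have mono: "cell_count x L' M b \<le> cell_count x L M b" for b
    unfolding cell_count_def using assms by (intro card_mono) auto
  have "discrepancy x L M \<le> (\<Sum>b<M. \<bar>real (cell_count x L' M b) - real L' / real M\<bar>
      + (real (cell_count x L M b) - real (cell_count x L' M b)) + (real L / real M - real L' / real M))"
    unfolding discrepancy_def
  proof (rule sum_mono)
    fix b
    have "real L' / real M \<le> real L / real M" using assms by (intro divide_right_mono) auto
    then show "\<bar>real (cell_count x L M b) - real L / real M\<bar>
      \<le> \<bar>real (cell_count x L' M b) - real L' / real M\<bar>
        + (real (cell_count x L M b) - real (cell_count x L' M b)) + (real L / real M - real L' / real M)"
      using mono[of b] by linarith
  qed
  also have "\<dots> = discrepancy x L' M + 2 * real (L - L')"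
    using assms total[of L] total[of L']
    by (simp add: sum.distrib sum_subtractf discrepancy_def of_nat_diff right_diff_distrib)
  finally show ?thesis .
qed

section \<open>From block deviations to \<alpha>-Poissonian pair correlations\<close>

lemma two_powr_affine:
  "2 powr (a - real n * c) = 2 powr a * (2 powr (- c)) ^ n" for a c :: real
  by (simp add: powr_power powr_add[symmetric])

lemma floor_log_at_top: "filterlim floor_log at_top sequentially"
proof (subst filterlim_at_top, intro allI)
  fix Z
  show "eventually (\<lambda>L. Z \<le> floor_log L) sequentially"
    using eventually_ge_at_top[of "2 ^ Z"]
    by eventually_elim (metis floor_log_le_iff floor_log_power)
qed

text \<open>For \<open>n = floor_log L\<close> the scale \<open>2 ^ (n - n div m)\<close> is about
  \<open>L powr (1 - 1 / m)\<close>, finer than \<open>L powr - \<alpha>\<close> for suitable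
  \<open>m\<close>, while blocks still contain \<open>2 ^ (n div m)\<close> cells. The deviation is
  assumed small only at the times given by fractions \<open>j / J\<close>, with natural parameters
  throughout; this keeps the assumption countable.\<close>

lemma alpha_ppc_if_block_deviation:
  assumes st: "\<And>n. 1 \<le> n \<Longrightarrow> stratified x (2 ^ n)"
    and new: "\<And>n k. 1 \<le> n \<Longrightarrow> k \<in> {1..2 ^ n} \<Longrightarrow> cell (2 ^ n) (x (2 ^ n + k)) = p n k - 1"
    and x: "\<And>i. 1 \<le> i \<Longrightarrow> 0 \<le> x i \<and> x i < 1"
    and p: "\<And>n. 1 \<le> n \<Longrightarrow> p n permutes {1..2 ^ n}"
    and dev: "\<And>m J j. 1 \<le> m \<Longrightarrow> j \<le> J \<Longrightarrow>
      (\<lambda>n. block_deviation (2 ^ (n - n div m)) (2 ^ (n div m)) (j * 2 ^ n div J) (p n) / 2 ^ n) \<longlonglongrightarrow> 0"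
    and \<alpha>: "0 < \<alpha>" "\<alpha> < 1"
  shows "alpha_ppc \<alpha> x"
proof -
  obtain m :: nat where m: "1 \<le> m" "1 / real m < 1 - \<alpha>"
    using ex_inverse_of_nat_less[of "1 - \<alpha>"] \<alpha> by (auto simp: inverse_eq_divide Suc_le_eq)
  define M where "M L = (2::nat) ^ (floor_log L - floor_log L div m)" for L
  define h where "h L = (2::nat) ^ (floor_log L div m)" for L
  have Mh: "M L * h L = 2 ^ floor_log L" for L
    by (simp add: M_def h_def power_add[symmetric])
  have pos: "0 < M L" "0 < h L" for L by (simp_all add: M_def h_def)
  have fl: "1 \<le> floor_log L" "2 ^ floor_log L \<le> L" "L < 2 * 2 ^ floor_log L" if "2 \<le> L" for L
    using that floor_log_exp2_le[of L] floor_log_exp2_gt[of L] floor_log_le_iff[of 2 L] floor_log_power[of 1]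
    by (auto simp del: floor_log_power)
  have cc: "cell_count x (2 ^ floor_log L + K) (M L) b
      = h L + card {k \<in> {1..K}. p (floor_log L) k \<in> {b * h L + 1..b * h L + h L}}"
    if "2 \<le> L" "K \<le> 2 ^ floor_log L" "b < M L" for L K b
    unfolding Mh[symmetric]
    by (rule cell_count_refinement) (use that pos st new x p fl Mh in auto)
  \<comment> \<open>A block holds \<open>h\<close> old points and, as the permutation is injective,
    at most \<open>h\<close> new ones; and \<open>2 * h = 2 * 2 ^ n / M \<le> 2 * L / M\<close> for
    \<open>n = floor_log L\<close>.\<close>
  have C: "real (cell_count x L (M L) b) \<le> 2 * real L / real (M L)" if L: "2 \<le> L" "b < M L" for L b
  proof -
    let ?n = "floor_log L"
    define K where "K = L - 2 ^ ?n"
    have K: "K \<le> 2 ^ ?n" "2 ^ ?n + K = L" using fl[OF L(1)] by (auto simp: K_def)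
    have "inj_on (p ?n) {1..K}"
      using p[OF fl(1)[OF L(1)]] by (meson inj_on_subset permutes_inj subset_UNIV)
    then have "card {k \<in> {1..K}. p ?n k \<in> {b * h L + 1..b * h L + h L}} \<le> card {b * h L + 1..b * h L + h L}"
      by (intro card_inj_on_le[of "p ?n"]) (auto elim: inj_on_subset)
    then have "cell_count x L (M L) b \<le> 2 * h L"
      using cc[OF L(1) K(1) L(2)] K(2) by simp
    then have "cell_count x L (M L) b * M L \<le> 2 * (M L * h L)" by (metis mult.assoc mult.commute mult_le_mono1)
    also have "\<dots> \<le> 2 * L" using fl[OF L(1)] by (simp add: Mh)
    finally have "real (cell_count x L (M L) b) * real (M L) \<le> 2 * real L"
      by (metis of_nat_le_iff of_nat_mult of_nat_numeral)
    then show ?thesis using pos[of L] by (simp add: field_simps)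
  qed
  show ?thesis
  proof (rule alpha_ppc_if_discrepancy[where M = M and C = 2])
    show "eventually (\<lambda>L. \<forall>b<M L. real (cell_count x L (M L) b) \<le> 2 * real L / real (M L)) sequentially"
      using eventually_ge_at_top[of 2] by eventually_elim (use C in blast)
    \<comment> \<open>The exponent left over from \<open>L \<le> 2 powr (1 + n)\<close> and
      \<open>M L \<ge> 2 powr (n - n / m)\<close>; it is positive by the choice of
      \<open>m\<close>.\<close>
    define c where "c = 1 - \<alpha> - 1 / real m"
    have c: "0 < c" using m by (simp add: c_def)
    have "(\<lambda>n. 2 powr \<alpha> * (2 powr (- c)) ^ n) \<longlonglongrightarrow> 2 powr \<alpha> * 0"
      using c by (intro tendsto_mult tendsto_const LIMSEQ_realpow_zero) (auto simp: powr_less_one)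
    then have lim: "(\<lambda>n. 2 powr (\<alpha> - real n * c)) \<longlonglongrightarrow> 0" by (simp add: two_powr_affine)
    show "(\<lambda>L. real L powr \<alpha> / real (M L)) \<longlonglongrightarrow> 0"
    proof (rule tendsto_sandwich[OF _ _ tendsto_const filterlim_compose[OF lim floor_log_at_top]])
      show "eventually (\<lambda>L. 0 \<le> real L powr \<alpha> / real (M L)) sequentially" by simp
      show "eventually (\<lambda>L. real L powr \<alpha> / real (M L) \<le> 2 powr (\<alpha> - real (floor_log L) * c)) sequentially"
        using eventually_ge_at_top[of 2]
      proof eventually_elim
        fix L :: nat assume L: "2 \<le> L"
        let ?n = "floor_log L"
        have "real L \<le> 2 powr (1 + real ?n)"
          using fl(3)[OF L] by (simp add: powr_add powr_realpow) (metis less_imp_le of_nat_le_iff of_nat_mult of_nat_numeral of_nat_power)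
        then have "real L powr \<alpha> \<le> (2 powr (1 + real ?n)) powr \<alpha>"
          using \<alpha> by (intro powr_mono2) auto
        also have "\<dots> = 2 powr ((1 + real ?n) * \<alpha>)" by (simp add: powr_powr)
        finally have 1: "real L powr \<alpha> \<le> 2 powr ((1 + real ?n) * \<alpha>)" .
        have "real (M L) = 2 powr real (?n - ?n div m)" by (subst powr_realpow) (auto simp: M_def)
        also have "\<dots> \<ge> 2 powr (real ?n - real ?n / real m)"
          using of_nat_div_le_of_nat[of ?n m, where ?'a = real] by (intro powr_mono) (auto simp: of_nat_diff)
        finally have 2: "2 powr (real ?n - real ?n / real m) \<le> real (M L)" .
        have "real L powr \<alpha> / real (M L) \<le> 2 powr ((1 + real ?n) * \<alpha>) / 2 powr (real ?n - real ?n / real m)"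
          using 1 2 by (intro frac_le) auto
        also have "\<dots> = 2 powr (\<alpha> - real ?n * c)"
          unfolding powr_diff[symmetric] c_def by (simp add: algebra_simps)
        finally show "real L powr \<alpha> / real (M L) \<le> 2 powr (\<alpha> - real ?n * c)" .
      qed
    qed
    define D where "D J n j = block_deviation (2 ^ (n - n div m)) (2 ^ (n div m)) (j * 2 ^ n div J) (p n) / 2 ^ n" for J n j
    have D_nonneg: "0 \<le> D J n j" for J n j
      by (simp add: D_def block_deviation_def sum_nonneg)
    \<comment> \<open>The time \<open>K\<close> after \<open>N\<close> is rounded down to the grid
      time \<open>K'\<close>, less than \<open>N / J + 1\<close> earlier, which costs
      \<open>2 / J + 2 / N\<close> after division by \<open>N\<close>. As \<open>j\<close> varies
      with \<open>L\<close>, its deviation is bounded by the sum over all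
      \<open>j \<le> J\<close>.\<close>
    have disc: "discrepancy x L (M L) / real L \<le> (\<Sum>j\<le>J. D J (floor_log L) j) + 2 / real J + 2 * (1 / 2) ^ floor_log L"
      if L: "2 \<le> L" and J: "0 < J" for L J
    proof -
      let ?n = "floor_log L"
      define N where "N = (2::nat) ^ ?n"
      have N: "0 < N" by (simp add: N_def)
      note fl = fl[OF L, folded N_def]
      define K where "K = L - N"
      have K: "K < N" "L = N + K" using fl by (auto simp: K_def)
      define j where "j = K * J div N"
      define K' where "K' = j * N div J"
      have "j * N \<le> K * J" unfolding j_def by (rule div_times_less_eq_dividend)
      then have K'K: "K' \<le> K" unfolding K'_def using J by (metis div_le_mono nonzero_mult_div_cancel_right not_gr0)
      have "K * J \<le> J * N" using K by (simp add: mult.commute)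
      then have jJ: "j \<le> J" unfolding j_def using N by (metis div_le_mono nonzero_mult_div_cancel_right not_gr0)
      have "K * J < (j + 1) * N"
        unfolding j_def using N by (metis Suc_eq_plus1 dividend_less_div_times add.commute mult_Suc)
      moreover have "j * N < (K' + 1) * J"
        unfolding K'_def using J by (metis Suc_eq_plus1 dividend_less_div_times add.commute mult_Suc)
      ultimately have "K * J < (K' + 1) * J + N" by (simp add: algebra_simps)
      then have "real (K * J) < real ((K' + 1) * J + N)" by (simp only: of_nat_less_iff)
      then have "(real K - real K' - 1) * real J < real N" by (simp add: algebra_simps)
      then have gap: "real K - real K' < real N / real J + 1" using J by (simp add: field_simps)
      have "discrepancy x (N + K') (M L) = D J ?n j * real N"
      proof -
        have MN: "real (N + K') / real (M L) = real (h L) + real K' / real (M L)"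
          using pos[of L] unfolding N_def Mh[symmetric] by (simp add: field_simps)
        have "discrepancy x (N + K') (M L) = block_deviation (M L) (h L) K' (p ?n)"
          unfolding discrepancy_def block_deviation_def MN
          using cc[OF L, of K', folded N_def] K'K K by (intro sum.cong refl) simp
        then show ?thesis by (simp add: D_def M_def h_def K'_def N_def)
      qed
      moreover have "D J ?n j \<le> (\<Sum>j\<le>J. D J ?n j)"
        using jJ D_nonneg by (intro member_le_sum) auto
      then have "D J ?n j * real N \<le> (\<Sum>j\<le>J. D J ?n j) * real N" by (intro mult_right_mono) auto
      moreover have "discrepancy x L (M L) \<le> discrepancy x (N + K') (M L) + 2 * real (L - (N + K'))"
        using x pos K'K K by (intro discrepancy_mono) (auto intro: cell_less)
      moreover have "L - (N + K') = K - K'" using K(2) by linarith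
      then have "real (L - (N + K')) = real K - real K'" using K'K by (simp only: of_nat_diff)
      ultimately have "discrepancy x L (M L) \<le> (\<Sum>j\<le>J. D J ?n j) * real N + 2 * (real K - real K')"
        by (smt (verit, best))
      also have "\<dots> \<le> (\<Sum>j\<le>J. D J ?n j) * real N + 2 * (real N / real J + 1)"
        using gap by (intro add_left_mono mult_left_mono) auto
      finally have "discrepancy x L (M L) \<le> (\<Sum>j\<le>J. D J ?n j) * real N + 2 * (real N / real J + 1)" .
      moreover have "discrepancy x L (M L) / real L \<le> discrepancy x L (M L) / real N"
      proof (rule divide_left_mono)
        show "real N \<le> real L" using fl(2) by (simp only: of_nat_le_iff)
      qed (use L N in \<open>auto simp: discrepancy_def intro: sum_nonneg\<close>)
      ultimately have "discrepancy x L (M L) / real L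
          \<le> ((\<Sum>j\<le>J. D J ?n j) * real N + 2 * (real N / real J + 1)) / real N"
        by (meson divide_right_mono of_nat_0_le_iff order_trans)
      also have "\<dots> = (\<Sum>j\<le>J. D J ?n j) + 2 / real J + 2 * (1 / 2) ^ ?n"
        using N by (simp add: N_def field_simps power_one_over)
      finally show ?thesis .
    qed
    show "(\<lambda>L. discrepancy x L (M L) / real L) \<longlonglongrightarrow> 0"
    proof (rule order_tendstoI)
      fix a :: real assume "a < 0"
      then show "eventually (\<lambda>L. a < discrepancy x L (M L) / real L) sequentially"
        by (intro always_eventually allI) (auto intro!: less_le_trans[of a 0] divide_nonneg_nonneg sum_nonneg simp: discrepancy_def)
    next
      fix e :: real assume "0 < e"
      \<comment> \<open>\<open>J\<close> is fixed first; the sum over \<open>j\<close> then has a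
        fixed number of terms, each tending to 0.\<close>
      then obtain J :: nat where J: "0 < J" "1 / real J < e / 2"
        using ex_inverse_of_nat_less[of "e / 2"] by (auto simp: inverse_eq_divide)
      have "(\<lambda>n. (\<Sum>j\<le>J. D J n j) + 2 / real J + 2 * (1 / 2) ^ n) \<longlonglongrightarrow> (\<Sum>j\<le>J. 0) + 2 / real J + 2 * 0"
        unfolding D_def by (intro tendsto_intros dev m LIMSEQ_realpow_zero) auto
      then have "(\<lambda>L. (\<Sum>j\<le>J. D J (floor_log L) j) + 2 / real J + 2 * (1 / 2) ^ floor_log L)
          \<longlonglongrightarrow> 2 / real J"
        using filterlim_compose[OF _ floor_log_at_top] by simp
      then have "eventually (\<lambda>L. (\<Sum>j\<le>J. D J (floor_log L) j) + 2 / real J + 2 * (1 / 2) ^ floor_log L < e) sequentially"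
        by (rule order_tendstoD(2)) (use J in \<open>simp add: field_simps\<close>)
      then show "eventually (\<lambda>L. discrepancy x L (M L) / real L < e) sequentially"
        using eventually_ge_at_top[of 2] by eventually_elim (use disc J in \<open>auto intro: le_less_trans\<close>)
    qed
  qed (use \<alpha> x pos in auto)
qed

section \<open>The random sequence\<close>

text \<open>The expectations are bounded by the summable \<open>a n\<close>, so the series of the
  nonnegative \<open>f n (Y n \<omega>)\<close> has finite expectation. It therefore converges
  almost surely, and its terms tend to 0.\<close>

lemma (in prob_space) AE_tendsto_0_uniform_count:
  fixes f :: "nat \<Rightarrow> 'b \<Rightarrow> real"
  assumes A: "\<And>n. finite (A n)" "\<And>n. A n \<noteq> {}"
    and Y: "\<And>n. Y n \<in> measurable M (count_space (A n))"
      "\<And>n. distr M (count_space (A n)) (Y n) = uniform_count_measure (A n)"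
    and f: "\<And>n y. 0 \<le> f n y"
    and avg: "\<And>n. (\<Sum>y\<in>A n. f n y) \<le> real (card (A n)) * a n" and a: "summable a"
  shows "AE \<omega> in M. (\<lambda>n. f n (Y n \<omega>)) \<longlonglongrightarrow> 0"
proof -
  have meas [measurable]: "(\<lambda>\<omega>. ennreal (f n (Y n \<omega>))) \<in> borel_measurable M" for n
    by (rule measurable_compose[OF Y(1)]) simp
  have card: "0 < real (card (A n))" for n using A by (simp add: card_gt_0_iff)
  have a0: "0 \<le> a n" for n
  proof -
    have "0 \<le> (\<Sum>y\<in>A n. f n y)" using f by (simp add: sum_nonneg)
    then show ?thesis using avg[of n] card[of n] by (metis order_trans zero_le_mult_iff not_less)
  qed
  have bound: "(\<integral>\<^sup>+ \<omega>. ennreal (f n (Y n \<omega>)) \<partial>M) \<le> ennreal (a n)" for n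
  proof -
    have "(\<integral>\<^sup>+ \<omega>. ennreal (f n (Y n \<omega>)) \<partial>M)
        = (\<integral>\<^sup>+ y. ennreal (f n y) \<partial>distr M (count_space (A n)) (Y n))"
      by (rule nn_integral_distr[OF Y(1), symmetric]) simp
    also have "\<dots> = (\<Sum>y\<in>A n. ennreal (1 / real (card (A n))) * ennreal (f n y))"
      unfolding Y(2) uniform_count_measure_def by (rule nn_integral_point_measure_finite[OF A(1)])
    also have "\<dots> = ennreal (\<Sum>y\<in>A n. 1 / real (card (A n)) * f n y)"
      using f unfolding ennreal_mult[OF divide_nonneg_nonneg[OF zero_le_one of_nat_0_le_iff] f, symmetric]
      by (intro sum_ennreal) simp
    also have "(\<Sum>y\<in>A n. 1 / real (card (A n)) * f n y) = (\<Sum>y\<in>A n. f n y) / real (card (A n))"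
      by (simp add: sum_divide_distrib)
    also have "ennreal \<dots> \<le> ennreal (a n)"
      using avg[of n] card[of n] by (intro ennreal_leI) (simp add: divide_le_eq mult.commute)
    finally show ?thesis .
  qed
  have "(\<integral>\<^sup>+ \<omega>. (\<Sum>n. ennreal (f n (Y n \<omega>))) \<partial>M) = (\<Sum>n. \<integral>\<^sup>+ \<omega>. ennreal (f n (Y n \<omega>)) \<partial>M)"
    by (rule nn_integral_suminf) measurable
  also have "\<dots> \<le> (\<Sum>n. ennreal (a n))" by (intro suminf_le bound) auto
  also have "\<dots> = ennreal (\<Sum>n. a n)" by (rule suminf_ennreal2[OF a0 a])
  also have "\<dots> < \<infinity>" by simp
  finally have "AE \<omega> in M. (\<Sum>n. ennreal (f n (Y n \<omega>))) \<noteq> \<infinity>"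
    by (intro nn_integral_PInf_AE) auto
  then show ?thesis
  proof eventually_elim
    case (elim \<omega>)
    then have "summable (\<lambda>n. f n (Y n \<omega>))" using f by (intro summable_suminf_not_top) auto
    then show ?case by (rule summable_LIMSEQ_zero)
  qed
qed

text \<open>Since \<open>n div m \<ge> n / m - 1\<close>, the terms are dominated by a geometric
  series with ratio \<open>2 powr (- 1 / (2 * m))\<close>.\<close>

lemma summable_inverse_sqrt_two_power_div:
  assumes "1 \<le> m"
  shows "summable (\<lambda>n. 1 / sqrt (2 ^ (n div m)))"
proof (rule summable_comparison_test')
  define c where "c = 1 / (2 * real m)"
  show "summable (\<lambda>n. 2 powr (1 / 2) * (2 powr (- c)) ^ n)"
    using assms by (intro summable_mult summable_geometric) (simp add: c_def powr_less_one)
  show "norm (1 / sqrt (2 ^ (n div m))) \<le> 2 powr (1 / 2) * (2 powr (- c)) ^ n" for n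
  proof -
    have "n < m + n div m * m" using assms by (intro dividend_less_div_times) simp
    then have "real n < real (m + n div m * m)" by (simp only: of_nat_less_iff)
    then have "real n / real m - 1 \<le> real (n div m)" using assms by (simp add: field_simps)
    moreover have "- (q / 2) \<le> 1 / 2 - t / 2" if "t - 1 \<le> q" for q t :: real
      using that by simp
    moreover have "real n * c = real n / real m / 2" by (simp add: c_def)
    ultimately have "- (real (n div m) / 2) \<le> 1 / 2 - real n * c" by metis
    moreover have "1 / sqrt (2 ^ (n div m)) = 2 powr (- (real (n div m) / 2))"
      by (simp add: powr_half_sqrt[symmetric] powr_realpow[symmetric] powr_powr powr_minus_divide)
    ultimately have "1 / sqrt (2 ^ (n div m)) \<le> 2 powr (1 / 2 - real n * c)" by simp
    then show ?thesis by (simp only: two_powr_affine) simp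
  qed
qed

theorem theorem1p4:
  fixes M :: "'a measure" and X :: "nat \<Rightarrow> 'a \<Rightarrow> real"
  assumes "sequential_jittered_sampling M X"
  shows "\<not> (AE \<omega> in M. ppc (\<lambda>n. X n \<omega>)) \<and>
         (AE \<omega> in M. \<forall>\<alpha>\<in>{0<..<1}. alpha_ppc \<alpha> (\<lambda>n. X n \<omega>))"
proof -
  interpret prob_space M using assms by (simp add: sequential_jittered_sampling_def)
  obtain \<pi> U where src: "sequential_jitter_source M \<pi> U"
    and seq: "\<And>\<omega>. \<omega> \<in> space M \<Longrightarrow> sequential_jittering (\<lambda>n. \<pi> n \<omega>) (\<lambda>i. U i \<omega>) (\<lambda>n. X n \<omega>)"
    using assms by (auto simp: sequential_jittered_sampling_def)
  have \<pi>: "\<pi> n \<in> measurable M (count_space (step_perms n))"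
      "distr M (count_space (step_perms n)) (\<pi> n) = uniform_count_measure (step_perms n)" for n
    using src by (auto simp: sequential_jitter_source_def)
  have U: "U i \<in> borel_measurable M" "distr M lborel (U i) = uniform_measure lborel {0..<1}"
    if "1 \<le> i" for i
    using src that by (auto simp: sequential_jitter_source_def)
  have perm: "\<pi> n \<omega> permutes {1..step_size n}" if "\<omega> \<in> space M" for n \<omega>
    using measurable_space[OF \<pi>(1)[of n] that] by (simp add: step_perms_def)
  have U01: "AE \<omega> in M. \<forall>i\<in>{1..}. 0 \<le> U i \<omega> \<and> U i \<omega> < 1"
  proof (rule AE_ball_countable')
    fix i :: nat assume "i \<in> {1..}"
    then have i: "1 \<le> i" by simp
    have "AE t in distr M lborel (U i). 0 \<le> t \<and> t < 1"
      unfolding U(2)[OF i] by (rule AE_uniform_measureI) auto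
    then show "AE \<omega> in M. 0 \<le> U i \<omega> \<and> U i \<omega> < 1"
      by (subst (asm) AE_distr_iff) (use U(1)[OF i] in auto)
  qed simp
  have dev: "AE \<omega> in M. (\<lambda>n. block_deviation (2 ^ (n - n div m)) (2 ^ (n div m)) (j * 2 ^ n div J) (\<pi> n \<omega>) / 2 ^ n) \<longlonglongrightarrow> 0"
    if m: "1 \<le> m" and j: "j \<le> J" for m j J
  proof -
    let ?d = "\<lambda>n p. block_deviation (2 ^ (n - n div m)) (2 ^ (n div m)) (j * 2 ^ n div J) p / 2 ^ n"
    \<comment> \<open>The index is shifted because \<open>step_size 0\<close> is 2 and not
      \<open>2 ^ 0\<close>; from index 1 on the permutations act on
      \<open>{1..2 ^ n}\<close>.\<close>
    have "AE \<omega> in M. (\<lambda>n. ?d (Suc n) (\<pi> (Suc n) \<omega>)) \<longlonglongrightarrow> 0"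
    proof (rule AE_tendsto_0_uniform_count[where A = "\<lambda>n. step_perms (Suc n)"
          and Y = "\<lambda>n. \<pi> (Suc n)" and f = "\<lambda>n. ?d (Suc n)" and a = "\<lambda>n. 1 / sqrt (2 ^ (Suc n div m))"])
      show "finite (step_perms (Suc n))" for n by (simp add: step_perms_def finite_permutations)
      show "step_perms (Suc n) \<noteq> {}" for n
        using permutes_id[of "{1..step_size (Suc n)}"] unfolding step_perms_def by blast
      show "0 \<le> ?d (Suc n) p" for n p by (simp add: block_deviation_def sum_nonneg)
      show "summable (\<lambda>n. 1 / sqrt (2 ^ (Suc n div m)))"
        using summable_inverse_sqrt_two_power_div[OF m] by (subst summable_Suc_iff)
      show "(\<Sum>p\<in>step_perms (Suc n). ?d (Suc n) p) \<le> real (card (step_perms (Suc n))) * (1 / sqrt (2 ^ (Suc n div m)))" for n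
      proof -
        define l where "l = Suc n"
        define L h where "L = (2::nat) ^ (l - l div m)" and "h = (2::nat) ^ (l div m)"
        have Lh: "L * h = 2 ^ l" by (simp add: L_def h_def power_add[symmetric])
        have pos: "0 < L" "0 < h" by (simp_all add: L_def h_def)
        have sp: "step_perms l = {p. p permutes {1..L * h}}"
          by (simp add: step_perms_def step_size_def Lh l_def)
        have card: "card (step_perms l) = fact (L * h)"
          unfolding sp by (subst card_permutations[OF refl]) auto
        \<comment> \<open>For \<open>J = 0\<close> the quotient is 0 by convention.\<close>
        have "j * 2 ^ l div J \<le> L * h"
          unfolding Lh using j div_le_mono[of "j * 2 ^ l" "J * 2 ^ l" J] by (cases "J = 0") auto
        then have "(\<Sum>p\<in>step_perms l. block_deviation L h (j * 2 ^ l div J) p) \<le> fact (L * h) * (real L * sqrt (real h))"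
          unfolding sp by (rule sum_block_deviation_le[OF pos])
        then have "(\<Sum>p\<in>step_perms l. block_deviation L h (j * 2 ^ l div J) p) / (real L * real h)
            \<le> fact (L * h) * (real L * sqrt (real h)) / (real L * real h)"
          by (intro divide_right_mono) auto
        also have "\<dots> = fact (L * h) * (1 / sqrt (real h))"
          using pos real_div_sqrt[of "real h"] by (simp add: field_simps)
        also have "real L * real h = 2 ^ l" unfolding of_nat_mult[symmetric] Lh by simp
        finally show ?thesis
          unfolding l_def[symmetric] card by (simp add: sum_divide_distrib L_def h_def)
      qed
    qed (use \<pi> in auto)
    then show ?thesis by eventually_elim (rule LIMSEQ_imp_Suc)
  qed
  \<comment> \<open>The parameters are natural numbers, so a single null set serves all of them and
    hence every \<alpha> at once.\<close>
  have dev': "AE \<omega> in M. \<forall>m J j. 1 \<le> m \<longrightarrow> j \<le> J \<longrightarrow>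
      (\<lambda>n. block_deviation (2 ^ (n - n div m)) (2 ^ (n div m)) (j * 2 ^ n div J) (\<pi> n \<omega>) / 2 ^ n) \<longlonglongrightarrow> 0"
    unfolding AE_all_countable using dev by auto
  note str = sequential_jittering_stratified[OF seq perm]
  \<comment> \<open>Almost sure failure is stronger than the required negation, which follows since
    in a probability space \<open>False\<close> cannot hold almost everywhere.\<close>
  have not_ppc: "AE \<omega> in M. \<not> ppc (\<lambda>n. X n \<omega>)"
    using U01 AE_space
  proof eventually_elim
    case (elim \<omega>)
    then show ?case by (intro not_ppc_if_stratified str) auto
  qed
  have "\<not> (AE \<omega> in M. ppc (\<lambda>n. X n \<omega>))"
  proof
    assume "AE \<omega> in M. ppc (\<lambda>n. X n \<omega>)"
    with not_ppc have "AE \<omega> in M. False" by eventually_elim simp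
    then show False by simp
  qed
  moreover have "AE \<omega> in M. \<forall>\<alpha>\<in>{0<..<1}. alpha_ppc \<alpha> (\<lambda>n. X n \<omega>)"
    using U01 AE_space dev'
  proof eventually_elim
    case (elim \<omega>)
    have perm_n: "\<pi> n \<omega> permutes {1..2 ^ n}" if "1 \<le> n" for n
      using perm[OF elim(2), of n] that by (simp add: step_size_def)
    show ?case
    proof
      fix \<alpha> :: real assume "\<alpha> \<in> {0<..<1}"
      then show "alpha_ppc \<alpha> (\<lambda>n. X n \<omega>)"
        using elim perm_n
        by (intro alpha_ppc_if_block_deviation[where p = "\<lambda>n. \<pi> n \<omega>"] str)
          auto
    qed
  qed
  ultimately show ?thesis by blast
qed

end
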